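(* Let $G$ be an abelian group with a character $\sigma:G\to\mathbb C^\times$. The $\widehat{\mathfrak u}_\nu(\mathcal R_\sigma,\bar{\ })$-module $M$ is completely reducible. Moreover, $$M=\bigoplus_{\gamma\in\mathbb Z_2^{[\nu/2]+1}}V_\nu(\gamma)\otimes\mathcal S(\mathcal H^-),$$ where each $V_\nu(\gamma)\otimes\mathcal S(\mathcal H^-)$ is an irreducible $\widehat{\mathfrak u}_\nu(\mathcal R_\sigma,\bar{\ })$-submodule.
   Context: Fix an integer $\nu\ge2$; $\mathbb N=\{0,1,2,\dots\}$, $\mathbb Z_2=\{\pm1\}$. Fock space and vertex operators. Let $\Gamma=\bigoplus_{i=1}^{\nu}\mathbb{Z}\epsilon_i$ with $(\epsilon_i,\epsilon_j)=\delta_{ij}$. Let $\mathcal H$ be the complex Lie algebra spanned by $\epsilon_i(n)$ ($1\le i\le\nu$, $n\in2\mathbb Z+1$) and a central element $1$, with $[\alpha(m),\beta(n)]=\frac m2(\alpha,\beta)\delta_{m+n,0}\,1$, where $\alpha(n)=\sum_i c_i\epsilon_i(n)$ for $\alpha=\sum_i c_i\epsilon_i\in\Gamma$. Let $\varepsilon:\Gamma\times\Gamma\to\{\pm1\}$ be bimultiplicative with $\varepsilon(\epsilon_i,\epsilon_j)=1$ if $i\le j$ and $-1$ if $i>j$. Let $\bar\Gamma=\Gamma/2\Gamma$ and let $\mathbb C[\bar\Gamma]$ be the twisted group algebra with basis $e^{\bar\alpha}$ and product $e^{\bar\alpha}e^{\bar\beta}=\varepsilon(\alpha,\beta)e^{\overline{\alpha+\beta}}$.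 Let $\mathcal H^-$ be the span of $\epsilon_i(n)$, $n\in-(2\mathbb N+1)$, and $M=\mathbb C[\bar\Gamma]\otimes\mathcal S(\mathcal H^-)$: $e^{\bar\alpha}$ acts by left multiplication on the first factor; on the symmetric algebra $\mathcal S(\mathcal H^-)$, $\epsilon_i(n)$ acts by multiplication if $n<0$ and, if $n>0$, as the derivation with $\epsilon_i(n)\cdot\epsilon_j(m)=\frac n2\delta_{ij}\delta_{m+n,0}$; $1$ acts as identity. Put $E_{\pm}(\alpha,z)=\exp\big(-2\sum_{n\in\pm(2\mathbb N+1)}\frac{\alpha(n)}{n}z^{-n}\big)$, $\epsilon_i(z)=\sum_{n\in2\mathbb Z+1}\epsilon_i(n)z^{-n}$. For $a\in\mathbb C^\times$ define $X_{ij}(a,z)=\varepsilon(\epsilon_i,\epsilon_j)e^{\overline{\epsilon_i-\epsilon_j}}E_-(\epsilon_i,z)E_-(-\epsilon_j,az)E_+(\epsilon_i,z)E_+(-\epsilon_j,az)$ if $i\ne j$; $X_{ii}(1,z)=4\epsilon_i(z)$; $X_{ii}(a,z)=\frac{1+a}{1-a}\big(E_-(\epsilon_i,z)E_-(-\epsilon_i,az)E_+(\epsilon_i,z)E_+(-\epsilon_i,az)-1\big)$ if $a\ne1$. Operators $x_{ij}(a,n)$ on $M$ are defined by $X_{ij}(a,z)=\sum_{n\in\mathbb Z}x_{ij}(a,n)z^{-n}$. Unitary Lie algebra. Write $G$ additively and $\tilde\alpha=\sigma(\alpha)$. $\mathcal R_\sigma$ is the associative $\mathbb C$-algebra with basis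 $t^me^\alpha$ ($m\in\mathbb Z,\alpha\in G$), where $e^\alpha e^\beta=e^{\alpha+\beta}$ and $e^\alpha t^m=\tilde\alpha^m t^me^\alpha$. The anti-involution $\bar{\ }$ is given by $\bar t=-t$, $\overline{e^\alpha}=e^{-\alpha}$. For $X\in M_\nu(\mathcal R_\sigma)$ put $X^*=\overline X^{\,t}$. $\mathfrak u_\nu(\mathcal R_\sigma,\bar{\ })=\{X\in M_\nu(\mathcal R_\sigma):X^*=-X\}$, a Lie algebra under the commutator, spanned by $e_{ij}(m,\alpha)=E_{ij}t^me^\alpha-E_{ji}\overline{t^me^\alpha}$. Let $\widehat{gl}_\nu(\mathcal R_\sigma)=gl_\nu(\mathcal R_\sigma)\oplus\mathbb Cc$ with $c$ central and $[E_{ij}t^me^\alpha,E_{kl}t^ne^\beta]=\delta_{jk}\tilde\alpha^nE_{il}t^{m+n}e^{\alpha+\beta}-\delta_{il}\tilde\beta^mE_{kj}t^{m+n}e^{\alpha+\beta}+m\delta_{il}\delta_{jk}\delta_{m+n,0}\delta_{\tilde\alpha\tilde\beta,1}\tilde\alpha^nc$; $\widehat{\mathfrak u}_\nu(\mathcal R_\sigma,\bar{\ })=\mathfrak u_\nu(\mathcal R_\sigma,\bar{\ })\oplus\mathbb Cc$ with the inherited bracket. It acts on $M$ by $2e_{ij}(m,\alpha)\mapsto x_{ij}(\tilde\alpha,m)+\delta_{m,0}\delta_{ij}(1-\delta_{\tilde\alpha,1})\frac{1+\tilde\alpha}{1-\tilde\alpha}$ (last term $0$ if $\tilde\alpha=1$),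 $c\mapsto\frac12$. The spaces $V_\nu(\gamma)$. For $\rho=\pm1$ let $w_{j}(\rho)=1+\sqrt{-1}\,\rho\, e^{\bar\epsilon_{j}}$ for $j$ odd and $w_{j}(\rho)=1+\rho\, e^{\bar\epsilon_{j}}$ for $j$ even, and $w(\rho_1,\dots,\rho_\nu)=w_1(\rho_1)w_2(\rho_2)\cdots w_\nu(\rho_\nu)\in\mathbb C[\bar\Gamma]$. Let $d=[\nu/2]$ and $\gamma=(\gamma_1,\dots,\gamma_{d+1})\in\mathbb Z_2^{d+1}$. If $\nu=2d+1$, $V_\nu(\gamma)$ is the span of those $w(\rho_1,\dots,\rho_\nu)$ ($\rho_i=\pm1$) with $\rho_1=\gamma_1$ and $\rho_{2j}\rho_{2j+1}=\gamma_{j+1}$ for $1\le j\le d$. If $\nu=2d$, $V_\nu(\gamma)$ is the span of those $w(\rho_1,\dots,\rho_\nu)$ with $\rho_1=\gamma_1$, $\rho_{2j}\rho_{2j+1}=\gamma_{j+1}$ for $1\le j\le d-1$, and $\rho_{2d}=\gamma_{d+1}$. *)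

theory Defs
  imports Complex_Main
    "HOL-Library.Poly_Mapping" "HOL-Library.Z2" "HOL-Library.FuncSet"
    "HOL-Library.Function_Algebras" "HOL-Library.Product_Plus"
begin

section \<open>Free complex vector spaces\<close>

text \<open>
  The complex vector space with basis \<open>'b\<close> is \<open>'b \<Rightarrow>\<^sub>0 complex\<close>. The basis vector
  \<open>b\<close> is \<open>Poly_Mapping.single b 1\<close>.
\<close>

abbreviation "lookup \<equiv> Poly_Mapping.lookup"
abbreviation "keys \<equiv> Poly_Mapping.keys"

definition pm_scale :: "complex \<Rightarrow> ('b \<Rightarrow>\<^sub>0 complex) \<Rightarrow> ('b \<Rightarrow>\<^sub>0 complex)" where
  "pm_scale c v = Poly_Mapping.map (\<lambda>x. c * x) v"

lemma lookup_pm_scale [simp]: "lookup (pm_scale c v) b = c * lookup v b"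
  by (simp add: pm_scale_def Poly_Mapping.map.rep_eq when_def)

lemma vector_space_pm_scale: "vector_space pm_scale"
  by (unfold_locales; rule poly_mapping_eqI) (simp_all add: lookup_add algebra_simps)

definition lin_ext ::
  "('b \<Rightarrow> ('c \<Rightarrow>\<^sub>0 complex)) \<Rightarrow> ('b \<Rightarrow>\<^sub>0 complex) \<Rightarrow> ('c \<Rightarrow>\<^sub>0 complex)" where
  "lin_ext f v = (\<Sum>b\<in>keys v. pm_scale (lookup v b) (f b))"

lemma lin_ext_single [simp]: "lin_ext f (Poly_Mapping.single b c) = pm_scale c (f b)"
  by (cases "c = 0") (auto simp: lin_ext_def intro!: poly_mapping_eqI)


section \<open>Modules over a Lie algebra\<close>

text \<open>
  The Lie algebra has underlying set \<open>L\<close>, scalar multiplication \<open>sL\<close> and bracket \<open>br\<close>;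
  the module is a subspace \<open>V\<close> of a type with scalar multiplication \<open>sV\<close>.
\<close>

definition lie_module ::
  "'l::plus set \<Rightarrow> (complex \<Rightarrow> 'l \<Rightarrow> 'l) \<Rightarrow> ('l \<Rightarrow> 'l \<Rightarrow> 'l) \<Rightarrow>
   'v::ab_group_add set \<Rightarrow> (complex \<Rightarrow> 'v \<Rightarrow> 'v) \<Rightarrow> ('l \<Rightarrow> 'v \<Rightarrow> 'v) \<Rightarrow> bool" where
  "lie_module L sL br V sV act \<longleftrightarrow>
     module.subspace sV V \<and>
     (\<forall>x\<in>L. \<forall>v\<in>V. act x v \<in> V) \<and>
     (\<forall>x\<in>L. \<forall>v\<in>V. \<forall>w\<in>V. act x (v + w) = act x v + act x w) \<and>
     (\<forall>x\<in>L. \<forall>v\<in>V. \<forall>c. act x (sV c v) = sV c (act x v)) \<and>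
     (\<forall>x\<in>L. \<forall>y\<in>L. \<forall>v\<in>V. act (x + y) v = act x v + act y v) \<and>
     (\<forall>x\<in>L. \<forall>v\<in>V. \<forall>c. act (sL c x) v = sV c (act x v)) \<and>
     (\<forall>x\<in>L. \<forall>y\<in>L. \<forall>v\<in>V. act (br x y) v = act x (act y v) - act y (act x v))"

definition submodule ::
  "'l set \<Rightarrow> 'v::ab_group_add set \<Rightarrow> (complex \<Rightarrow> 'v \<Rightarrow> 'v) \<Rightarrow> ('l \<Rightarrow> 'v \<Rightarrow> 'v) \<Rightarrow>
   'v set \<Rightarrow> bool" where
  "submodule L V sV act N \<longleftrightarrow>
     N \<subseteq> V \<and> module.subspace sV N \<and> (\<forall>x\<in>L. \<forall>v\<in>N. act x v \<in> N)"

definition irreducible_submodule ::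
  "'l set \<Rightarrow> 'v::ab_group_add set \<Rightarrow> (complex \<Rightarrow> 'v \<Rightarrow> 'v) \<Rightarrow> ('l \<Rightarrow> 'v \<Rightarrow> 'v) \<Rightarrow>
   'v set \<Rightarrow> bool" where
  "irreducible_submodule L V sV act N \<longleftrightarrow>
     submodule L V sV act N \<and> N \<noteq> {0} \<and>
     (\<forall>N'. submodule L V sV act N' \<and> N' \<subseteq> N \<longrightarrow> N' = {0} \<or> N' = N)"

text \<open>Internal direct sum of a possibly infinite family of subspaces.\<close>

definition direct_sum :: "'i set \<Rightarrow> ('i \<Rightarrow> 'v::ab_group_add set) \<Rightarrow> 'v set \<Rightarrow> bool" where
  "direct_sum I W V \<longleftrightarrow>
     (\<forall>i\<in>I. W i \<subseteq> V) \<and>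
     (\<forall>v\<in>V. \<exists>!f. (\<forall>i\<in>I. f i \<in> W i) \<and> (\<forall>i. i \<notin> I \<longrightarrow> f i = 0) \<and>
        finite {i. f i \<noteq> 0} \<and> v = (\<Sum>i | f i \<noteq> 0. f i))"

definition completely_reducible ::
  "'l set \<Rightarrow> 'v::ab_group_add set \<Rightarrow> (complex \<Rightarrow> 'v \<Rightarrow> 'v) \<Rightarrow> ('l \<Rightarrow> 'v \<Rightarrow> 'v) \<Rightarrow> bool" where
  "completely_reducible L V sV act \<longleftrightarrow>
     (\<exists>S. (\<forall>W\<in>S. irreducible_submodule L V sV act W) \<and> direct_sum S (\<lambda>W. W) V)"


section \<open>The twisted group algebra\<close>

text \<open>
  The lattice \<open>\<Gamma>\<close> consists of the elements of \<open>nat \<Rightarrow>\<^sub>0 int\<close> with support in \<open>{1..\<nu>}\<close>, and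
  \<open>\<Gamma>/2\<Gamma>\<close> of the elements of \<open>nat \<Rightarrow>\<^sub>0 bit\<close> with support in \<open>{1..\<nu>}\<close>; the quotient map
  \<open>cls\<close> reduces the coordinates modulo 2.
\<close>

type_synonym lat = "nat \<Rightarrow>\<^sub>0 int"
type_synonym lat2 = "nat \<Rightarrow>\<^sub>0 bit"

definition eps :: "nat \<Rightarrow> lat" where
  "eps i = Poly_Mapping.single i 1"

definition cls :: "lat \<Rightarrow> lat2" where
  "cls \<alpha> = Poly_Mapping.map of_int \<alpha>"

definition rep :: "lat2 \<Rightarrow> lat" where
  "rep x = Poly_Mapping.map (\<lambda>b. if b = 0 then 0 else 1) x"

lemma cls_rep [simp]: "cls (rep x) = x"
proof (rule poly_mapping_eqI)
  fix i
  show "lookup (cls (rep x)) i = lookup x i"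
    by (cases "lookup x i") (simp_all add: cls_def rep_def Poly_Mapping.map.rep_eq when_def)
qed

definition cocyc :: "lat \<Rightarrow> lat \<Rightarrow> complex" where
  "cocyc \<alpha> \<beta> = (\<Prod>i\<in>keys \<alpha>. \<Prod>j\<in>keys \<beta>.
      if i \<le> j then 1 else (-1) powi (lookup \<alpha> i * lookup \<beta> j))"

lemma cocyc_superset:
  assumes "finite A" "finite B" "keys \<alpha> \<subseteq> A" "keys \<beta> \<subseteq> B"
  shows "cocyc \<alpha> \<beta> = (\<Prod>i\<in>A. \<Prod>j\<in>B.
      if i \<le> j then 1 else (-1) powi (lookup \<alpha> i * lookup \<beta> j))"
proof -
  have "cocyc \<alpha> \<beta> = (\<Prod>i\<in>keys \<alpha>. \<Prod>j\<in>B.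
      if i \<le> j then 1 else (-1) powi (lookup \<alpha> i * lookup \<beta> j))"
    unfolding cocyc_def using assms
    by (intro prod.cong refl prod.mono_neutral_left) (auto simp: in_keys_iff)
  also have "\<dots> = (\<Prod>i\<in>A. \<Prod>j\<in>B.
      if i \<le> j then 1 else (-1) powi (lookup \<alpha> i * lookup \<beta> j))"
    using assms by (intro prod.mono_neutral_left) (auto simp: in_keys_iff intro!: prod.neutral)
  finally show ?thesis .
qed

lemma cocyc_eps: "cocyc (eps i) (eps j) = (if i \<le> j then 1 else -1)"
  by (simp add: cocyc_def eps_def)

lemma cocyc_add_left: "cocyc (\<alpha> + \<alpha>') \<beta> = cocyc \<alpha> \<beta> * cocyc \<alpha>' \<beta>"
proof -
  let ?A = "keys \<alpha> \<union> keys \<alpha>'"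
  have "keys (\<alpha> + \<alpha>') \<subseteq> ?A" by (rule Poly_Mapping.keys_add)
  then show ?thesis
    by (subst (1 2 3) cocyc_superset[of ?A "keys \<beta>"])
       (auto simp: prod.distrib[symmetric] lookup_add algebra_simps power_int_add
             intro!: prod.cong)
qed

lemma cocyc_add_right: "cocyc \<alpha> (\<beta> + \<beta>') = cocyc \<alpha> \<beta> * cocyc \<alpha> \<beta>'"
proof -
  let ?B = "keys \<beta> \<union> keys \<beta>'"
  have "keys (\<beta> + \<beta>') \<subseteq> ?B" by (rule Poly_Mapping.keys_add)
  then show ?thesis
    by (subst (1 2 3) cocyc_superset[of "keys \<alpha>" ?B])
       (auto simp: prod.distrib[symmetric] lookup_add algebra_simps power_int_add
             intro!: prod.cong)
qed

lemma powi_minus_one_parity: "(-1 :: complex) powi k = (if even k then 1 else -1)"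
  by (auto simp: power_int_def even_nat_iff)

lemma cocyc_cls:
  assumes "cls \<alpha> = cls \<alpha>'" "cls \<beta> = cls \<beta>'"
  shows "cocyc \<alpha> \<beta> = cocyc \<alpha>' \<beta>'"
proof -
  have par: "even (lookup \<gamma> i) \<longleftrightarrow> even (lookup \<gamma>' i)" if "cls \<gamma> = cls \<gamma>'" for \<gamma> \<gamma>' :: lat and i
  proof -
    have "(of_int (lookup \<gamma> i) :: bit) = of_int (lookup \<gamma>' i)"
      using arg_cong[OF that, of "\<lambda>x. lookup x i"]
      by (auto simp: cls_def Poly_Mapping.map.rep_eq when_def split: if_splits)
    moreover have "(of_int k :: bit) = 0 \<longleftrightarrow> even k" for k :: int
      by (metis bit_2_eq_0 dvd_0_left_iff even_of_int_iff dvd_refl)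
    ultimately show ?thesis by metis
  qed
  show ?thesis
    by (subst (1 2) cocyc_superset[of "keys \<alpha> \<union> keys \<alpha>'" "keys \<beta> \<union> keys \<beta>'"])
       (auto intro!: prod.cong simp: powi_minus_one_parity par[OF assms(1)] par[OF assms(2)])
qed

text \<open>By \<open>cocyc_cls\<close> the product below is \<open>e\<^sup>\<alpha> e\<^sup>\<beta> = cocyc \<alpha> \<beta> e\<^sup>\<alpha>\<^sup>+\<^sup>\<beta>\<close> for arbitrary representatives.\<close>

definition gmul :: "(lat2 \<Rightarrow>\<^sub>0 complex) \<Rightarrow> (lat2 \<Rightarrow>\<^sub>0 complex) \<Rightarrow> (lat2 \<Rightarrow>\<^sub>0 complex)" where
  "gmul u v = lin_ext (\<lambda>x. lin_ext (\<lambda>y.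
      Poly_Mapping.single (x + y) (cocyc (rep x) (rep y))) v) u"


section \<open>The Fock space\<close>

text \<open>
  The variables of the symmetric algebra are the pairs \<open>(i, n)\<close>, standing for \<open>\<epsilon>\<^sub>i(n)\<close> with
  \<open>1 \<le> i \<le> \<nu>\<close> and \<open>n\<close> negative odd. A monomial is its exponent vector, so
  \<open>mono \<Rightarrow>\<^sub>0 complex\<close> is the polynomial ring and \<open>lat2 \<times> mono \<Rightarrow>\<^sub>0 complex\<close> its tensor
  product with the twisted group algebra.
\<close>

type_synonym mono = "nat \<times> int \<Rightarrow>\<^sub>0 nat"
type_synonym fock = "lat2 \<times> mono \<Rightarrow>\<^sub>0 complex"

definition Sym :: "nat \<Rightarrow> (mono \<Rightarrow>\<^sub>0 complex) set" where
  "Sym \<nu> = {p. \<forall>m\<in>keys p. \<forall>(i, n)\<in>keys m. i \<in> {1..\<nu>} \<and> n < 0 \<and> odd n}"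

definition Fock :: "nat \<Rightarrow> fock set" where
  "Fock \<nu> = {v. \<forall>(x, m)\<in>keys v. keys x \<subseteq> {1..\<nu>} \<and>
      (\<forall>(i, n)\<in>keys m. i \<in> {1..\<nu>} \<and> n < 0 \<and> odd n)}"

definition tensor :: "(lat2 \<Rightarrow>\<^sub>0 complex) \<Rightarrow> (mono \<Rightarrow>\<^sub>0 complex) \<Rightarrow> fock" where
  "tensor u p = lin_ext (\<lambda>x. lin_ext (\<lambda>m. Poly_Mapping.single (x, m) 1) p) u"

definition tensor_space ::
  "(lat2 \<Rightarrow>\<^sub>0 complex) set \<Rightarrow> (mono \<Rightarrow>\<^sub>0 complex) set \<Rightarrow> fock set" where
  "tensor_space U P = module.span pm_scale {tensor u p | u p. u \<in> U \<and> p \<in> P}"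

definition grp_op :: "lat2 \<Rightarrow> fock \<Rightarrow> fock" where
  "grp_op x = lin_ext (\<lambda>(y, m). Poly_Mapping.single (x + y, m) (cocyc (rep x) (rep y)))"

text \<open>
  The action of \<open>\<epsilon>\<^sub>i(n)\<close>. For \<open>n > 0\<close> it is the derivation \<open>(n/2) \<partial>/\<partial>\<epsilon>\<^sub>i(-n)\<close>, written out on
  monomials (the subtraction of exponents is truncated only when the coefficient vanishes).
\<close>

definition heis1 :: "nat \<Rightarrow> int \<Rightarrow> fock \<Rightarrow> fock" where
  "heis1 i n = lin_ext (\<lambda>(x, m).
     if n < 0 then Poly_Mapping.single (x, m + Poly_Mapping.single (i, n) 1) 1
     else Poly_Mapping.single (x, m - Poly_Mapping.single (i, -n) 1)
            (of_int n / 2 * of_nat (lookup m (i, -n))))"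

definition heis :: "lat \<Rightarrow> int \<Rightarrow> fock \<Rightarrow> fock" where
  "heis \<alpha> n v = (\<Sum>i\<in>keys \<alpha>. pm_scale (of_int (lookup \<alpha> i)) (heis1 i n v))"


section \<open>Vertex operators\<close>

text \<open>
  Formal power series of operators are sequences of coefficients. In \<open>ser_exp\<close> the series
  has no constant term, so only the powers up to \<open>N\<close> contribute to the coefficient \<open>N\<close>.
\<close>

type_synonym op_series = "nat \<Rightarrow> fock \<Rightarrow> fock"

definition ser_mul :: "op_series \<Rightarrow> op_series \<Rightarrow> op_series" where
  "ser_mul A B N v = (\<Sum>k\<le>N. A k (B (N - k) v))"

primrec ser_pow :: "op_series \<Rightarrow> nat \<Rightarrow> op_series" where
  "ser_pow A 0 = (\<lambda>N v. if N = 0 then v else 0)"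
| "ser_pow A (Suc k) = ser_mul A (ser_pow A k)"

definition ser_exp :: "op_series \<Rightarrow> op_series" where
  "ser_exp A N v = (\<Sum>k\<le>N. pm_scale (1 / fact k) (ser_pow A k N v))"

text \<open>
  For a sign \<open>s = \<plusminus>1\<close>, the operators \<open>E_coeff s \<alpha> a p\<close> are the coefficients of
  \<open>z\<^bsup>-sp\<^esup>\<close> (\<open>p \<ge> 0\<close>) in \<open>E\<^sub>\<plusminus>(\<alpha>, a z)\<close>: the exponent of the latter is a series in \<open>z\<close> for
  \<open>s = -1\<close> and in \<open>z\<^bsup>-1\<^esup>\<close> for \<open>s = 1\<close>.
\<close>

definition E_exponent :: "int \<Rightarrow> lat \<Rightarrow> complex \<Rightarrow> op_series" where
  "E_exponent s \<alpha> a p v =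
     (if odd p then pm_scale (- 2 / of_int (s * int p) * a powi (- (s * int p)))
                      (heis \<alpha> (s * int p) v) else 0)"

definition E_coeff :: "int \<Rightarrow> lat \<Rightarrow> complex \<Rightarrow> op_series" where
  "E_coeff s \<alpha> a = ser_exp (E_exponent s \<alpha> a)"

text \<open>
  The coefficient of \<open>z\<^bsup>-n\<^esup>\<close> in \<open>E\<^sub>-(\<epsilon>\<^sub>i,z) E\<^sub>-(-\<epsilon>\<^sub>j,az) E\<^sub>+(\<epsilon>\<^sub>i,z) E\<^sub>+(-\<epsilon>\<^sub>j,az)\<close>: a term of degree
  \<open>q\<close> in \<open>z\<^bsup>-1\<^esup>\<close> meets one of degree \<open>q - n\<close> in \<open>z\<close>. On each vector only finitely many \<open>q\<close>
  contribute.
\<close>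

definition EE_coeff :: "nat \<Rightarrow> nat \<Rightarrow> complex \<Rightarrow> int \<Rightarrow> fock \<Rightarrow> fock" where
  "EE_coeff i j a n v = Sum_any (\<lambda>q::nat. if n \<le> int q then
      ser_mul (E_coeff (-1) (eps i) 1) (E_coeff (-1) (- eps j) a) (nat (int q - n))
        (ser_mul (E_coeff 1 (eps i) 1) (E_coeff 1 (- eps j) a) q v) else 0)"

definition x_op :: "nat \<Rightarrow> nat \<Rightarrow> complex \<Rightarrow> int \<Rightarrow> fock \<Rightarrow> fock" where
  "x_op i j a n v =
     (if i \<noteq> j then
        pm_scale (cocyc (eps i) (eps j)) (grp_op (cls (eps i - eps j)) (EE_coeff i j a n v))
      else if a = 1 then (if odd n then pm_scale 4 (heis (eps i) n v) else 0)
      else pm_scale ((1 + a) / (1 - a)) (EE_coeff i i a n v - (if n = 0 then v else 0)))"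


section \<open>The unitary Lie algebra\<close>

text \<open>
  \<open>Poly_Mapping.single (m, \<alpha>) 1\<close> is \<open>t\<^sup>m e\<^sup>\<alpha>\<close>. The anti-involution sends it to
  \<open>e\<^bsup>-\<alpha>\<^esup> (-t)\<^sup>m = (-1)\<^sup>m \<sigma>(-\<alpha>)\<^sup>m t\<^sup>m e\<^bsup>-\<alpha>\<^esup>\<close>.
\<close>

type_synonym 'g rsig = "int \<times> 'g \<Rightarrow>\<^sub>0 complex"

definition character :: "('g::ab_group_add \<Rightarrow> complex) \<Rightarrow> bool" where
  "character \<sigma> \<longleftrightarrow> (\<forall>\<alpha>. \<sigma> \<alpha> \<noteq> 0) \<and> (\<forall>\<alpha> \<beta>. \<sigma> (\<alpha> + \<beta>) = \<sigma> \<alpha> * \<sigma> \<beta>)"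

definition rmul :: "('g::ab_group_add \<Rightarrow> complex) \<Rightarrow> 'g rsig \<Rightarrow> 'g rsig \<Rightarrow> 'g rsig" where
  "rmul \<sigma> r s = lin_ext (\<lambda>(m, \<alpha>). lin_ext (\<lambda>(n, \<beta>).
      Poly_Mapping.single (m + n, \<alpha> + \<beta>) (\<sigma> \<alpha> powi n)) s) r"

definition rbar :: "('g::ab_group_add \<Rightarrow> complex) \<Rightarrow> 'g rsig \<Rightarrow> 'g rsig" where
  "rbar \<sigma> = lin_ext (\<lambda>(m, \<alpha>).
      Poly_Mapping.single (m, - \<alpha>) ((-1) powi m * \<sigma> (- \<alpha>) powi m))"

text \<open>Matrices are functions vanishing outside \<open>{1..\<nu>} \<times> {1..\<nu>}\<close>.\<close>

type_synonym 'g rmat = "nat \<Rightarrow> nat \<Rightarrow> 'g rsig"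

definition Mat :: "nat \<Rightarrow> 'g rmat set" where
  "Mat \<nu> = {X. \<forall>i j. X i j \<noteq> 0 \<longrightarrow> i \<in> {1..\<nu>} \<and> j \<in> {1..\<nu>}}"

definition mat_unit :: "nat \<Rightarrow> nat \<Rightarrow> 'g rsig \<Rightarrow> 'g rmat" where
  "mat_unit i j r = (\<lambda>k l. if k = i \<and> l = j then r else 0)"

definition mmul ::
  "nat \<Rightarrow> ('g::ab_group_add \<Rightarrow> complex) \<Rightarrow> 'g rmat \<Rightarrow> 'g rmat \<Rightarrow> 'g rmat" where
  "mmul \<nu> \<sigma> X Y = (\<lambda>i l. \<Sum>j\<in>{1..\<nu>}. rmul \<sigma> (X i j) (Y j l))"

definition mstar :: "('g::ab_group_add \<Rightarrow> complex) \<Rightarrow> 'g rmat \<Rightarrow> 'g rmat" where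
  "mstar \<sigma> X = (\<lambda>i j. rbar \<sigma> (X j i))"

definition e_gen ::
  "('g::ab_group_add \<Rightarrow> complex) \<Rightarrow> nat \<Rightarrow> nat \<Rightarrow> int \<Rightarrow> 'g \<Rightarrow> 'g rmat" where
  "e_gen \<sigma> i j m \<alpha> =
     mat_unit i j (Poly_Mapping.single (m, \<alpha>) 1)
     - mat_unit j i (rbar \<sigma> (Poly_Mapping.single (m, \<alpha>) 1))"

text \<open>
  The pair \<open>(X, a)\<close> is the element \<open>X + a c\<close> of the central extension. The bracket is the
  commutator plus the bilinear cocycle; \<open>ghat_bracket_basis\<close> gives it on the basis.
\<close>

definition ghat_cocycle ::
  "nat \<Rightarrow> ('g::ab_group_add \<Rightarrow> complex) \<Rightarrow> 'g rmat \<Rightarrow> 'g rmat \<Rightarrow> complex" where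
  "ghat_cocycle \<nu> \<sigma> X Y = (\<Sum>i\<in>{1..\<nu>}. \<Sum>j\<in>{1..\<nu>}.
     \<Sum>(m, \<alpha>)\<in>keys (X i j). \<Sum>(n, \<beta>)\<in>keys (Y j i).
       lookup (X i j) (m, \<alpha>) * lookup (Y j i) (n, \<beta>) *
       (if m + n = 0 \<and> \<sigma> \<alpha> * \<sigma> \<beta> = 1 then of_int m * \<sigma> \<alpha> powi n else 0))"

definition ghat_bracket ::
  "nat \<Rightarrow> ('g::ab_group_add \<Rightarrow> complex) \<Rightarrow> 'g rmat \<times> complex \<Rightarrow> 'g rmat \<times> complex \<Rightarrow>
   'g rmat \<times> complex" where
  "ghat_bracket \<nu> \<sigma> x y =
     (mmul \<nu> \<sigma> (fst x) (fst y) - mmul \<nu> \<sigma> (fst y) (fst x), ghat_cocycle \<nu> \<sigma> (fst x) (fst y))"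

definition ghat_scale :: "complex \<Rightarrow> 'g rmat \<times> complex \<Rightarrow> 'g rmat \<times> complex" where
  "ghat_scale b x = ((\<lambda>i j. pm_scale b (fst x i j)), b * snd x)"

definition uhat ::
  "nat \<Rightarrow> ('g::ab_group_add \<Rightarrow> complex) \<Rightarrow> ('g rmat \<times> complex) set" where
  "uhat \<nu> \<sigma> = {x. fst x \<in> Mat \<nu> \<and> mstar \<sigma> (fst x) = - fst x}"

lemma ghat_bracket_basis:
  assumes "i \<in> {1..\<nu>}" "j \<in> {1..\<nu>}" "k \<in> {1..\<nu>}" "l \<in> {1..\<nu>}"
  shows "ghat_bracket \<nu> \<sigma> (mat_unit i j (Poly_Mapping.single (m, \<alpha>) 1), 0)
           (mat_unit k l (Poly_Mapping.single (n, \<beta>) 1), 0) =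
         ((if j = k then mat_unit i l (Poly_Mapping.single (m + n, \<alpha> + \<beta>) (\<sigma> \<alpha> powi n)) else 0)
          - (if i = l then mat_unit k j (Poly_Mapping.single (m + n, \<alpha> + \<beta>) (\<sigma> \<beta> powi m)) else 0),
          if i = l \<and> j = k \<and> m + n = 0 \<and> \<sigma> \<alpha> * \<sigma> \<beta> = 1 then of_int m * \<sigma> \<alpha> powi n else 0)"
proof -
  have rm0: "rmul \<sigma> 0 s = 0" "rmul \<sigma> s 0 = 0" for s :: "'a rsig"
    by (auto simp: rmul_def lin_ext_def intro!: poly_mapping_eqI sum.neutral)
  have rm1: "rmul \<sigma> (Poly_Mapping.single (m, \<alpha>) 1) (Poly_Mapping.single (n, \<beta>) 1) =
      Poly_Mapping.single (m + n, \<alpha> + \<beta>) (\<sigma> \<alpha> powi n)" for m n \<alpha> \<beta>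
    by (simp add: rmul_def) (auto intro!: poly_mapping_eqI)
  have mm: "mmul \<nu> \<sigma> (mat_unit i j r) (mat_unit k l s) =
      (if j = k then mat_unit i l (rmul \<sigma> r s) else 0)"
    if "j \<in> {1..\<nu>}" for i j k l and r s :: "'a rsig"
  proof (intro ext)
    fix p q
    have "mmul \<nu> \<sigma> (mat_unit i j r) (mat_unit k l s) p q =
        (\<Sum>x\<in>{1..\<nu>}. if x = j then
           (if p = i \<and> j = k \<and> q = l then rmul \<sigma> r s else 0) else 0)"
      unfolding mmul_def mat_unit_def by (intro sum.cong refl) (auto simp: rm0)
    also have "\<dots> = (if p = i \<and> j = k \<and> q = l then rmul \<sigma> r s else 0)"
      using that by (subst sum.delta) auto
    finally show "mmul \<nu> \<sigma> (mat_unit i j r) (mat_unit k l s) p q =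
        (if j = k then mat_unit i l (rmul \<sigma> r s) else 0) p q"
      by (auto simp: mat_unit_def)
  qed
  have coc: "ghat_cocycle \<nu> \<sigma> (mat_unit i j (Poly_Mapping.single (m, \<alpha>) 1))
      (mat_unit k l (Poly_Mapping.single (n, \<beta>) 1)) =
      (if i = l \<and> j = k \<and> m + n = 0 \<and> \<sigma> \<alpha> * \<sigma> \<beta> = 1 then of_int m * \<sigma> \<alpha> powi n else 0)"
      (is "_ = ?c")
  proof -
    have "ghat_cocycle \<nu> \<sigma> (mat_unit i j (Poly_Mapping.single (m, \<alpha>) 1))
        (mat_unit k l (Poly_Mapping.single (n, \<beta>) 1)) =
        (\<Sum>p\<in>{1..\<nu>}. \<Sum>q\<in>{1..\<nu>}. if q = j then (if p = i then ?c else 0) else 0)"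
      unfolding ghat_cocycle_def mat_unit_def
      by (intro sum.cong refl) auto
    also have "\<dots> = ?c"
      using assms by (simp add: sum.delta)
    finally show ?thesis .
  qed
  show ?thesis
    using assms by (auto simp: ghat_bracket_def mm coc rm1 add.commute)
qed


section \<open>The subspaces of the twisted group algebra\<close>

definition w_factor :: "nat \<Rightarrow> int \<Rightarrow> (lat2 \<Rightarrow>\<^sub>0 complex)" where
  "w_factor j r = Poly_Mapping.single 0 1
     + Poly_Mapping.single (cls (eps j)) ((if odd j then \<i> else 1) * of_int r)"

primrec w_prod :: "nat \<Rightarrow> (nat \<Rightarrow> int) \<Rightarrow> (lat2 \<Rightarrow>\<^sub>0 complex)" where
  "w_prod 0 \<rho> = Poly_Mapping.single 0 1"
| "w_prod (Suc k) \<rho> = gmul (w_prod k \<rho>) (w_factor (Suc k) (\<rho> (Suc k)))"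

definition V_space :: "nat \<Rightarrow> (nat \<Rightarrow> int) \<Rightarrow> (lat2 \<Rightarrow>\<^sub>0 complex) set" where
  "V_space \<nu> \<gamma> = (let d = \<nu> div 2 in
     module.span pm_scale {w_prod \<nu> \<rho> | \<rho>.
       (\<forall>i\<in>{1..\<nu>}. \<rho> i \<in> {1, -1}) \<and> \<rho> 1 = \<gamma> 1 \<and>
       (if odd \<nu> then \<forall>j\<in>{1..d}. \<rho> (2 * j) * \<rho> (2 * j + 1) = \<gamma> (j + 1)
        else (\<forall>j\<in>{1..d - 1}. \<rho> (2 * j) * \<rho> (2 * j + 1) = \<gamma> (j + 1)) \<and>
             \<rho> (2 * d) = \<gamma> (d + 1))})"

end

theory Submission
  imports Defs
begin

text \<open>
  The vector \<open>w(\<rho>) \<otimes> m\<close>, with \<open>\<rho>\<close> a sign vector and \<open>m\<close> a monomial of the symmetric algebra, is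
  \<open>w_vec \<nu> \<rho> m\<close>. Because the cocycle is trivial on increasing products, the coordinates of \<open>w(\<rho>)\<close>
  are the values \<open>w_char \<nu> \<rho> x\<close>, up to fourth roots of unity the characters of the elementary
  abelian group \<open>\<Gamma>/2\<Gamma>\<close>. Orthogonality of characters (\<open>w_char_orthogonal\<close>, \<open>w_char_complete\<close>)
  therefore makes the vectors \<open>w(\<rho>) \<otimes> m\<close> a basis of the Fock space, with explicit coordinate
  projections \<open>w_proj\<close>.

  On this basis the group algebra acts monomially: \<open>e_i\<close>, the class of \<open>\<epsilon>\<^sub>i\<close>, sends \<open>w(\<rho>)\<close> to a
  nonzero multiple of \<open>w(flip_signs i \<rho>)\<close> (\<open>grp_op_eps_w_vec\<close>), where \<open>flip_signs i\<close> negates an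
  initial segment of odd length. Two such moves together only negate whole pairs
  \<open>{2k, 2k + 1}\<close>, so they preserve the parameters of \<open>\<rho>\<close> that define \<open>\<gamma>\<close> (\<open>sign_class_flip_flip\<close>).
  Hence each \<open>V(\<gamma>) \<otimes> S\<close>, which is spanned by a part of the basis (\<open>tensor_space_eq_block\<close>), is
  stable under \<open>e_i e_j\<close> and under all Heisenberg operators, thus under all coefficients of the
  vertex operators (\<open>x_op_stable\<close>). Those coefficients and the central element exhaust the Lie
  algebra up to linear combinations (\<open>uhat_decomposition\<close>), which gives the decomposition into
  submodules.

  Irreducibility (\<open>fock_block_minimal\<close>) comes from the elements \<open>e_ij(n, 0)\<close>. The operators
  \<open>x_ii(1, n)\<close> with odd \<open>n\<close> are multiples of the Heisenberg operators. Annihilators lower the degree, so a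
  nonzero submodule contains a nonzero vector of \<open>\<complex>[\<Gamma>/2\<Gamma>] \<otimes> 1\<close>. On such vectors \<open>x_ij(1, 0)\<close> is
  just \<open>e_i e_j\<close> (\<open>x_op_vacuum\<close>). The products \<open>e_(2k-1) e_(2k)\<close> are simultaneously diagonal with
  eigenvalues that, within one block, separate the sign vectors, so some single \<open>w(\<rho>) \<otimes> 1\<close> lies in
  the submodule; the products \<open>e_(2k) e_(2k+1)\<close> move it to all other \<open>w(\<rho>') \<otimes> 1\<close> of the block; and
  the creation operators produce every \<open>w(\<rho>') \<otimes> m\<close>.
\<close>

section \<open>Linear extensions\<close>

interpretation pm: vector_space pm_scale
  by (rule vector_space_pm_scale)

lemma lookup_lin_ext: "lookup (lin_ext f v) c = (\<Sum>b\<in>keys v. lookup v b * lookup (f b) c)"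
  by (simp add: lin_ext_def lookup_sum)

lemma lookup_lin_ext_superset:
  assumes "finite A" "keys v \<subseteq> A"
  shows "lookup (lin_ext f v) c = (\<Sum>b\<in>A. lookup v b * lookup (f b) c)"
  unfolding lookup_lin_ext using assms
  by (intro sum.mono_neutral_left) (auto simp: in_keys_iff)

lemma lin_ext_add: "lin_ext f (u + v) = lin_ext f u + lin_ext f v"
proof (rule poly_mapping_eqI)
  fix c
  show "lookup (lin_ext f (u + v)) c = lookup (lin_ext f u + lin_ext f v) c"
    using keys_add[of u v]
    by (simp add: lookup_add lookup_lin_ext_superset[of "keys u \<union> keys v"] algebra_simps sum.distrib)
qed

lemma lin_ext_scale: "lin_ext f (pm_scale a v) = pm_scale a (lin_ext f v)"
proof (rule poly_mapping_eqI)
  fix c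
  have "keys (pm_scale a v) \<subseteq> keys v" by (auto simp: in_keys_iff)
  then show "lookup (lin_ext f (pm_scale a v)) c = lookup (pm_scale a (lin_ext f v)) c"
    by (simp add: lookup_lin_ext_superset[of "keys v"] sum_distrib_left mult.assoc)
qed

lemma lin_ext_0 [simp]: "lin_ext f 0 = 0"
  by (simp add: lin_ext_def)

lemma lin_ext_sum: "lin_ext f (sum g A) = (\<Sum>a\<in>A. lin_ext f (g a))"
  by (induction A rule: infinite_finite_induct) (simp_all add: lin_ext_add)

lemma lin_ext_diff: "lin_ext f (u - v) = lin_ext f u - lin_ext f v"
  by (metis add_diff_cancel_right' diff_add_cancel lin_ext_add)

lemma lin_ext_lin_ext: "lin_ext f (lin_ext g v) = lin_ext (\<lambda>b. lin_ext f (g b)) v"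
  by (simp add: lin_ext_def[of g] lin_ext_def[of "\<lambda>b. lin_ext f (g b)"] lin_ext_sum lin_ext_scale)

lemma lin_ext_fun_scale: "lin_ext (\<lambda>b. pm_scale a (f b)) v = pm_scale a (lin_ext f v)"
  by (rule poly_mapping_eqI) (simp add: lookup_lin_ext sum_distrib_left algebra_simps)

lemma lin_ext_fun_sum: "lin_ext (\<lambda>b. \<Sum>a\<in>A. f a b) v = (\<Sum>a\<in>A. lin_ext (f a) v)"
proof (rule poly_mapping_eqI)
  fix c
  have "(\<Sum>b\<in>keys v. \<Sum>a\<in>A. lookup v b * lookup (f a b) c)
      = (\<Sum>a\<in>A. \<Sum>b\<in>keys v. lookup v b * lookup (f a b) c)"
    by (rule sum.swap)
  then show "lookup (lin_ext (\<lambda>b. \<Sum>a\<in>A. f a b) v) c = lookup (\<Sum>a\<in>A. lin_ext (f a) v) c"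
    by (simp add: lookup_lin_ext lookup_sum sum_distrib_left)
qed

lemma lin_ext_cong: "(\<And>b. b \<in> keys v \<Longrightarrow> f b = g b) \<Longrightarrow> lin_ext f v = lin_ext g v"
  by (simp add: lin_ext_def)

lemma lin_ext_of_singles: "lin_ext (\<lambda>b. Poly_Mapping.single b 1) v = v"
proof (rule poly_mapping_eqI)
  fix c
  have "lookup (lin_ext (\<lambda>b. Poly_Mapping.single b 1) v) c
      = (\<Sum>b\<in>keys v. if b = c then lookup v c else 0)"
    unfolding lookup_lin_ext by (intro sum.cong refl) (auto simp: lookup_single)
  also have "\<dots> = lookup v c" by (auto simp: in_keys_iff)
  finally show "lookup (lin_ext (\<lambda>b. Poly_Mapping.single b 1) v) c = lookup v c" .
qed

lemma pm_scale_single: "pm_scale a (Poly_Mapping.single b c) = Poly_Mapping.single b (a * c)"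
  by (rule poly_mapping_eqI) (simp add: lookup_single when_def)

lemma sum_of_singles:
  fixes v :: "'b \<Rightarrow>\<^sub>0 complex"
  shows "v = (\<Sum>b\<in>keys v. Poly_Mapping.single b (lookup v b))"
  using lin_ext_of_singles[of v] by (simp add: lin_ext_def pm_scale_single)

lemma subspace_lin_ext:
  assumes "module.subspace pm_scale T" "\<And>b. b \<in> keys v \<Longrightarrow> f b \<in> T"
  shows "lin_ext f v \<in> T"
  unfolding lin_ext_def using assms by (intro pm.subspace_sum pm.subspace_scale) auto

lemma subspace_vimage_lin_ext:
  assumes "module.subspace pm_scale T"
  shows "module.subspace pm_scale {v. lin_ext f v \<in> T}"
  unfolding pm.subspace_def
  by (auto simp: lin_ext_add lin_ext_scale intro: pm.subspace_0 pm.subspace_add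
      pm.subspace_scale assms)

section \<open>The lattice modulo 2\<close>

lemma lat2_double [simp]: "x + x = (0 :: lat2)"
proof (rule poly_mapping_eqI)
  fix k show "lookup (x + x) k = lookup 0 k"
    unfolding lookup_add by (cases "lookup x k") simp_all
qed

lemma lat2_add_cancel [simp]: "(a :: lat2) + (a + y) = y" "(y :: lat2) + a + a = y"
  by (metis add.assoc add_0 lat2_double, metis add.assoc add_0_right lat2_double)

lemma lookup_cls: "lookup (cls \<alpha>) k = of_int (lookup \<alpha> k)"
  by (simp add: cls_def Poly_Mapping.map.rep_eq when_def)

lemma cls_add: "cls (\<alpha> + \<beta>) = cls \<alpha> + cls \<beta>"
  by (rule poly_mapping_eqI) (simp add: lookup_cls lookup_add del: add_bit_eq_xor)

lemma cls_eps: "cls (eps i) = Poly_Mapping.single i 1"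
  by (simp add: cls_def eps_def)

lemma cls_diff: "cls (\<alpha> - \<beta>) = cls (\<alpha> + \<beta>)"
proof -
  have "cls (\<alpha> - \<beta>) + cls \<beta> = cls (\<alpha> + \<beta>) + cls \<beta>"
    by (metis cls_add diff_add_cancel add.assoc add_0_right lat2_double)
  then show ?thesis by simp
qed

lemma keys_add_single_lat2:
  "keys (x + Poly_Mapping.single i 1 :: lat2) = (if i \<in> keys x then keys x - {i} else insert i (keys x))"
  by (auto simp: in_keys_iff lookup_add lookup_single when_def split: if_splits)

section \<open>Coordinates of the vectors w\<close>

definition w_const :: "nat \<Rightarrow> complex" where
  "w_const j = (if odd j then \<i> else 1)"

text \<open>
  Up to powers of \<open>\<i>\<close> these are the characters of \<open>(\<int>/2)\<^sup>\<nu>\<close>.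
\<close>

definition w_char :: "nat \<Rightarrow> (nat \<Rightarrow> int) \<Rightarrow> lat2 \<Rightarrow> complex" where
  "w_char \<nu> \<rho> x = (\<Prod>j\<in>{1..\<nu>}. if lookup x j = 0 then 1 else w_const j * of_int (\<rho> j))"

lemma w_factor_alt:
  "w_factor j r = Poly_Mapping.single 0 1 + Poly_Mapping.single (Poly_Mapping.single j 1) (w_const j * of_int r)"
  by (simp add: w_factor_def w_const_def cls_eps)

lemma lookup_lin_ext_shift:
  "lookup (lin_ext (\<lambda>x. Poly_Mapping.single (x + a) c) u) (y :: lat2) = c * lookup u (y + a)"
proof -
  have "lookup (lin_ext (\<lambda>x. Poly_Mapping.single (x + a) c) u) y
      = (\<Sum>b\<in>keys u. if b = y + a then c * lookup u (y + a) else 0)"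
    unfolding lookup_lin_ext
    by (intro sum.cong refl) (auto simp: lookup_single when_def)
  also have "\<dots> = c * lookup u (y + a)" by (auto simp: in_keys_iff)
  finally show ?thesis .
qed

lemma rep_0: "rep 0 = 0" by (rule poly_mapping_eqI) (simp add: rep_def Poly_Mapping.map.rep_eq)

lemma lookup_rep: "lookup (rep x) k = (if lookup x k = 0 then 0 else 1)"
  by (simp add: rep_def Poly_Mapping.map.rep_eq when_def)

lemma keys_rep: "keys (rep x) = keys x"
  by (intro set_eqI) (simp add: in_keys_iff lookup_rep del: bit_not_zero_iff)

lemma cocyc_0: "cocyc \<alpha> 0 = 1"
  by (simp add: cocyc_def)

lemma cocyc_increasing:
  assumes "\<And>l. l \<in> keys \<alpha> \<Longrightarrow> l \<le> j"
  shows "cocyc \<alpha> (eps j) = 1"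
  using assms by (auto simp: cocyc_def eps_def intro!: prod.neutral)

text \<open>
  The new factor has a larger index than everything in \<open>u\<close>, so the cocycle is 1 and the product
  is the untwisted one. This is what keeps signs out of the coordinates of \<open>w_prod\<close>.
\<close>

lemma lookup_gmul_w_factor:
  assumes "\<And>x. x \<in> keys u \<Longrightarrow> keys x \<subseteq> {1..<j}"
  shows "lookup (gmul u (w_factor j r)) y
    = lookup u y + w_const j * of_int r * lookup u (y + Poly_Mapping.single j 1)"
proof -
  let ?e = "Poly_Mapping.single j 1 :: lat2" and ?c = "w_const j * of_int r"
  have "gmul u (w_factor j r) = lin_ext (\<lambda>x. Poly_Mapping.single (x + 0) 1 + Poly_Mapping.single (x + ?e) ?c) u"
    unfolding gmul_def
  proof (rule lin_ext_cong)
    fix x assume x: "x \<in> keys u"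
    have "cocyc (rep x) (rep ?e) = cocyc (rep x) (eps j)"
      by (rule cocyc_cls) (simp_all add: cls_eps)
    also have "\<dots> = 1" using assms[OF x] by (intro cocyc_increasing) (auto simp: keys_rep)
    finally have *: "cocyc (rep x) (rep ?e) = 1" .
    show "lin_ext (\<lambda>y. Poly_Mapping.single (x + y) (cocyc (rep x) (rep y))) (w_factor j r)
      = Poly_Mapping.single (x + 0) 1 + Poly_Mapping.single (x + ?e) ?c"
      by (simp add: w_factor_alt lin_ext_add * rep_0 cocyc_0 pm_scale_single del: single_one)
  qed
  also have "\<dots> = lin_ext (\<lambda>x. Poly_Mapping.single (x + 0) 1) u + lin_ext (\<lambda>x. Poly_Mapping.single (x + ?e) ?c) u"
    by (rule poly_mapping_eqI) (simp add: lookup_lin_ext lookup_add algebra_simps sum.distrib)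
  finally show ?thesis by (simp only: lookup_add lookup_lin_ext_shift add_0_right lin_ext_of_singles)
qed

lemma bit_cases: "(b::bit) = 0 \<or> b = 1" by (cases b) auto

text \<open>
  Expanding the product \<open>w_1 \<cdots> w_\<nu>\<close> in increasing order yields one term for every subset of
  \<open>{1..\<nu>}\<close>, and no sign.
\<close>

lemma lookup_w_prod:
  "lookup (w_prod k \<rho>) x = (if keys x \<subseteq> {1..k} then w_char k \<rho> x else 0)"
proof (induction k arbitrary: x)
  case 0
  then show ?case by (auto simp: w_char_def lookup_single when_def simp del: single_one)
next
  case (Suc k)
  let ?e = "Poly_Mapping.single (Suc k) 1 :: lat2"
  have l: "lookup (w_prod (Suc k) \<rho>) x = lookup (w_prod k \<rho>) x
      + w_const (Suc k) * of_int (\<rho> (Suc k)) * lookup (w_prod k \<rho>) (x + ?e)"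
    unfolding w_prod.simps
  proof (rule lookup_gmul_w_factor)
    fix y assume "y \<in> keys (w_prod k \<rho>)"
    then show "keys y \<subseteq> {1..<Suc k}"
      using Suc.IH[of y] by (auto simp: in_keys_iff split: if_splits)
  qed
  have char: "w_char k \<rho> (x + ?e) = w_char k \<rho> x"
    by (auto simp: w_char_def lookup_add lookup_single when_def intro!: prod.cong)
  have char_Suc: "w_char (Suc k) \<rho> x = w_char k \<rho> x *
      (if lookup x (Suc k) = 0 then 1 else w_const (Suc k) * of_int (\<rho> (Suc k)))"
    by (simp add: w_char_def)
  show ?case
  proof (cases "Suc k \<in> keys x")
    case True
    then have "\<not> keys x \<subseteq> {1..k}" "keys (x + ?e) \<subseteq> {1..k} \<longleftrightarrow> keys x \<subseteq> {1..Suc k}"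
      by (auto simp: keys_add_single_lat2 le_Suc_eq subset_iff)
    moreover have "lookup x (Suc k) \<noteq> 0" using True by (simp add: in_keys_iff)
    ultimately show ?thesis
      unfolding l Suc.IH char char_Suc by (simp only: if_False add_0 mult.commute) simp
  next
    case False
    then have "\<not> keys (x + ?e) \<subseteq> {1..k}" "keys x \<subseteq> {1..k} \<longleftrightarrow> keys x \<subseteq> {1..Suc k}"
      by (auto simp: keys_add_single_lat2 le_Suc_eq subset_iff)
    moreover have "lookup x (Suc k) = 0" using False by (simp add: in_keys_iff)
    ultimately show ?thesis
      unfolding l Suc.IH char_Suc by simp
  qed
qed

definition sign_vectors :: "nat \<Rightarrow> (nat \<Rightarrow> int) set" where
  "sign_vectors \<nu> = {1..\<nu>} \<rightarrow>\<^sub>E {1, -1}"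

definition lat2_below :: "nat \<Rightarrow> lat2 set" where
  "lat2_below \<nu> = {x. keys x \<subseteq> {1..\<nu>}}"

definition neg_odd_monos :: "nat \<Rightarrow> mono set" where
  "neg_odd_monos \<nu> = {m. \<forall>(i, n)\<in>keys m. i \<in> {1..\<nu>} \<and> n < 0 \<and> odd n}"

lemma Fock_alt: "Fock \<nu> = {v. keys v \<subseteq> lat2_below \<nu> \<times> neg_odd_monos \<nu>}"
  by (auto simp: Fock_def lat2_below_def neg_odd_monos_def)

lemma Sym_alt: "Sym \<nu> = {p. keys p \<subseteq> neg_odd_monos \<nu>}"
  by (auto simp: Sym_def neg_odd_monos_def)

lemma finite_sign_vectors: "finite (sign_vectors \<nu>)"
  unfolding sign_vectors_def by (intro finite_PiE) auto

lemma w_const_norm: "w_const j * cnj (w_const j) = 1"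
  by (simp add: w_const_def)

lemma w_char_cnj: "cnj (w_char \<nu> \<rho> x) = (\<Prod>j\<in>{1..\<nu>}. if lookup x j = 0 then 1 else cnj (w_const j) * of_int (\<rho> j))"
  unfolding w_char_def cnj_prod by (intro prod.cong) auto

text \<open>
  Both orthogonality relations hold because the sum of a product over all choices is a product
  of sums, one for each coordinate, and \<open>w_const j\<close> has modulus 1.
\<close>

lemma w_char_complete:
  assumes "x \<in> lat2_below \<nu>" "y \<in> lat2_below \<nu>"
  shows "(\<Sum>\<rho>\<in>sign_vectors \<nu>. w_char \<nu> \<rho> x * cnj (w_char \<nu> \<rho> y)) = (if x = y then 2 ^ \<nu> else 0)"
proof -
  let ?g = "\<lambda>j (r::int). (if lookup x j = 0 then 1 else w_const j * of_int r)
      * (if lookup y j = 0 then 1 else cnj (w_const j) * of_int r)"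
  have "(\<Sum>\<rho>\<in>sign_vectors \<nu>. w_char \<nu> \<rho> x * cnj (w_char \<nu> \<rho> y))
      = (\<Sum>\<rho>\<in>{1..\<nu>} \<rightarrow>\<^sub>E {1, -1}. \<Prod>j\<in>{1..\<nu>}. ?g j (\<rho> j))"
    unfolding sign_vectors_def w_char_cnj unfolding w_char_def prod.distrib ..
  also have "\<dots> = (\<Prod>j\<in>{1..\<nu>}. \<Sum>r\<in>{1, -1}. ?g j r)"
    by (rule prod_sum_PiE[symmetric]) auto
  also have "\<dots> = (\<Prod>j\<in>{1..\<nu>}. if lookup x j = lookup y j then 2 else 0)"
    using w_const_norm by (intro prod.cong refl) auto
  also have "\<dots> = (if x = y then 2 ^ \<nu> else 0)"
  proof (cases "x = y")
    case False
    then obtain j where j: "lookup x j \<noteq> lookup y j" by (meson poly_mapping_eqI)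
    then have "j \<in> {1..\<nu>}" using assms
      by (metis (mono_tags, lifting) in_keys_iff lat2_below_def mem_Collect_eq subsetD)
    with j False show ?thesis by auto
  qed auto
  finally show ?thesis .
qed

lemma bij_lat2_below: "bij_betw (\<lambda>x. restrict (lookup x) {1..\<nu>}) (lat2_below \<nu>) ({1..\<nu>} \<rightarrow>\<^sub>E UNIV)"
proof (rule bij_betw_byWitness[where f' = "\<lambda>g. Abs_poly_mapping (\<lambda>j. if j \<in> {1..\<nu>} then g j else 0)"])
  have fin: "finite {j. (if j \<in> {1..\<nu>} then g j else 0) \<noteq> (0::bit)}" for g
    by (rule finite_subset[of _ "{1..\<nu>}"]) auto
  have lk: "lookup (Abs_poly_mapping (\<lambda>j. if j \<in> {1..\<nu>} then g j else 0)) l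
      = (if l \<in> {1..\<nu>} then g l else 0)" for g :: "nat \<Rightarrow> bit" and l
    by (subst lookup_Abs_poly_mapping[OF fin]) (rule refl)
  show "\<forall>x\<in>lat2_below \<nu>. Abs_poly_mapping (\<lambda>j. if j \<in> {1..\<nu>} then restrict (lookup x) {1..\<nu>} j else 0) = x"
  proof
    fix x assume x: "x \<in> lat2_below \<nu>"
    have "(\<lambda>j. if j \<in> {1..\<nu>} then restrict (lookup x) {1..\<nu>} j else 0) = lookup x"
    proof
      fix j show "(if j \<in> {1..\<nu>} then restrict (lookup x) {1..\<nu>} j else 0) = lookup x j"
        using x by (cases "j \<in> keys x") (auto simp: lat2_below_def not_in_keys_iff_lookup_eq_zero)
    qed
    then show "Abs_poly_mapping (\<lambda>j. if j \<in> {1..\<nu>} then restrict (lookup x) {1..\<nu>} j else 0) = x"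
      by (simp only: lookup_inverse)
  qed
  show "\<forall>g\<in>{1..\<nu>} \<rightarrow>\<^sub>E (UNIV :: bit set). restrict (lookup (Abs_poly_mapping (\<lambda>j. if j \<in> {1..\<nu>} then g j else 0))) {1..\<nu>} = g"
  proof (intro ballI ext)
    fix g :: "nat \<Rightarrow> bit" and l assume "g \<in> {1..\<nu>} \<rightarrow>\<^sub>E UNIV"
    then show "restrict (lookup (Abs_poly_mapping (\<lambda>j. if j \<in> {1..\<nu>} then g j else 0))) {1..\<nu>} l = g l"
      unfolding restrict_apply lk by (auto simp: PiE_def extensional_def)
  qed
  show "(\<lambda>g. Abs_poly_mapping (\<lambda>j. if j \<in> {1..\<nu>} then g j else 0)) ` ({1..\<nu>} \<rightarrow>\<^sub>E UNIV) \<subseteq> lat2_below \<nu>"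
    by (auto simp only: lat2_below_def in_keys_iff lk split: if_splits)
qed auto

lemma UNIV_bit: "(UNIV :: bit set) = {0, 1}"
  using bit_cases by auto

lemma finite_lat2_below: "finite (lat2_below \<nu>)"
  using bij_betw_finite[OF bij_lat2_below[of \<nu>]] by (simp add: finite_PiE UNIV_bit)

lemma w_char_orthogonal:
  assumes "\<rho> \<in> {1..\<nu>} \<rightarrow> {1, -1}" "\<rho>' \<in> {1..\<nu>} \<rightarrow> {1, -1}"
  shows "(\<Sum>x\<in>lat2_below \<nu>. w_char \<nu> \<rho> x * cnj (w_char \<nu> \<rho>' x))
    = (if \<forall>j\<in>{1..\<nu>}. \<rho> j = \<rho>' j then 2 ^ \<nu> else 0)"
proof -
  let ?g = "\<lambda>j b. (if b = (0::bit) then 1 else w_const j * of_int (\<rho> j))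
      * (if b = 0 then 1 else cnj (w_const j) * of_int (\<rho>' j))"
  have "(\<Sum>x\<in>lat2_below \<nu>. w_char \<nu> \<rho> x * cnj (w_char \<nu> \<rho>' x))
      = (\<Sum>x\<in>lat2_below \<nu>. \<Prod>j\<in>{1..\<nu>}. ?g j (restrict (lookup x) {1..\<nu>} j))"
    unfolding w_char_cnj unfolding w_char_def prod.distrib[symmetric]
    by (intro sum.cong prod.cong refl) auto
  also have "\<dots> = (\<Sum>h\<in>{1..\<nu>} \<rightarrow>\<^sub>E UNIV. \<Prod>j\<in>{1..\<nu>}. ?g j (h j))"
    by (rule sum.reindex_bij_betw[OF bij_lat2_below])
  also have "\<dots> = (\<Prod>j\<in>{1..\<nu>}. \<Sum>b\<in>UNIV. ?g j b)"
    by (rule prod_sum_PiE[symmetric]) (auto simp: UNIV_bit)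
  also have "\<dots> = (\<Prod>j\<in>{1..\<nu>}. if \<rho> j = \<rho>' j then 2 else 0)"
  proof (intro prod.cong refl)
    fix j assume "j \<in> {1..\<nu>}"
    then have "\<rho> j \<in> {1, -1}" "\<rho>' j \<in> {1, -1}" using assms by blast+
    then show "(\<Sum>b\<in>UNIV. ?g j b) = (if \<rho> j = \<rho>' j then 2 else 0)"
      using w_const_norm[of j] by (auto simp: UNIV_bit)
  qed
  also have "\<dots> = (if \<forall>j\<in>{1..\<nu>}. \<rho> j = \<rho>' j then 2 ^ \<nu> else 0)" by auto
  finally show ?thesis .
qed

definition w_vec :: "nat \<Rightarrow> (nat \<Rightarrow> int) \<Rightarrow> mono \<Rightarrow> fock" where
  "w_vec \<nu> \<rho> m = tensor (w_prod \<nu> \<rho>) (Poly_Mapping.single m 1)"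

lemma w_vec_alt: "w_vec \<nu> \<rho> m = lin_ext (\<lambda>x. Poly_Mapping.single (x, m) 1) (w_prod \<nu> \<rho>)"
  by (simp add: w_vec_def tensor_def)

lemma lookup_lin_ext_single_pair:
  "lookup (lin_ext (\<lambda>x. Poly_Mapping.single (x, m) 1) u) (y, m') = (if m' = m then lookup u y else 0)"
proof -
  have "lookup (lin_ext (\<lambda>x. Poly_Mapping.single (x, m) 1) u) (y, m')
      = (\<Sum>b\<in>keys u. if b = y then (if m' = m then lookup u y else 0) else 0)"
    unfolding lookup_lin_ext by (intro sum.cong refl) (auto simp: lookup_single when_def)
  then show ?thesis by (auto simp: in_keys_iff)
qed

lemma lookup_w_vec:
  "lookup (w_vec \<nu> \<rho> m) (x, m') = (if m' = m \<and> x \<in> lat2_below \<nu> then w_char \<nu> \<rho> x else 0)"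
  by (simp add: w_vec_alt lookup_lin_ext_single_pair lookup_w_prod lat2_below_def)

lemma w_char_cong: "(\<And>j. j \<in> {1..\<nu>} \<Longrightarrow> \<rho> j = \<rho>' j) \<Longrightarrow> w_char \<nu> \<rho> = w_char \<nu> \<rho>'"
  unfolding w_char_def by (intro ext prod.cong) auto

lemma w_vec_cong: "(\<And>j. j \<in> {1..\<nu>} \<Longrightarrow> \<rho> j = \<rho>' j) \<Longrightarrow> w_vec \<nu> \<rho> m = w_vec \<nu> \<rho>' m"
proof (rule poly_mapping_eqI, clarify)
  fix x m'
  assume "\<And>j. j \<in> {1..\<nu>} \<Longrightarrow> \<rho> j = \<rho>' j"
  then have "w_char \<nu> \<rho> = w_char \<nu> \<rho>'" by (rule w_char_cong)
  then show "lookup (w_vec \<nu> \<rho> m) (x, m') = lookup (w_vec \<nu> \<rho>' m) (x, m')"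
    by (simp add: lookup_w_vec)
qed

lemma w_vec_nonzero: "w_vec \<nu> \<rho> m \<noteq> 0"
proof
  assume "w_vec \<nu> \<rho> m = 0"
  then have "lookup (w_vec \<nu> \<rho> m) (0, m) = 0" by simp
  then show False by (simp add: lookup_w_vec lat2_below_def w_char_def)
qed

lemma w_vec_in_Fock: "m \<in> neg_odd_monos \<nu> \<Longrightarrow> w_vec \<nu> \<rho> m \<in> Fock \<nu>"
  by (auto simp: Fock_alt in_keys_iff lookup_w_vec split: if_splits)

lemma subspace_Fock: "module.subspace pm_scale (Fock \<nu>)"
proof -
  have "Fock \<nu> = {v. \<forall>b. b \<notin> lat2_below \<nu> \<times> neg_odd_monos \<nu> \<longrightarrow> lookup v b = 0}"
    by (auto simp: Fock_alt in_keys_iff subset_iff)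
  then show ?thesis
    by (simp only:) (simp add: pm.subspace_def lookup_add)
qed

text \<open>
  Fourier inversion on \<open>\<Gamma>/2\<Gamma>\<close>: the coordinate of \<open>e\<^sup>x\<close> at \<open>w(\<rho>)\<close> is the complex conjugate of the
  character value, divided by the order of the group.
\<close>

definition w_proj :: "nat \<Rightarrow> (nat \<Rightarrow> int) \<Rightarrow> fock \<Rightarrow> fock" where
  "w_proj \<nu> \<rho> = lin_ext (\<lambda>(x, m). pm_scale (cnj (w_char \<nu> \<rho> x) / 2 ^ \<nu>) (w_vec \<nu> \<rho> m))"

lemma w_proj_w_vec:
  assumes "\<rho> \<in> {1..\<nu>} \<rightarrow> {1, -1}" "\<rho>' \<in> {1..\<nu>} \<rightarrow> {1, -1}"
  shows "w_proj \<nu> \<rho> (w_vec \<nu> \<rho>' m) = (if \<forall>j\<in>{1..\<nu>}. \<rho>' j = \<rho> j then w_vec \<nu> \<rho> m else 0)"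
proof -
  have "w_proj \<nu> \<rho> (w_vec \<nu> \<rho>' m)
      = lin_ext (\<lambda>x. pm_scale (cnj (w_char \<nu> \<rho> x) / 2 ^ \<nu>) (w_vec \<nu> \<rho> m)) (w_prod \<nu> \<rho>')"
    by (simp add: w_proj_def w_vec_alt[of \<nu> \<rho>'] lin_ext_lin_ext)
  also have "\<dots> = pm_scale ((\<Sum>x\<in>lat2_below \<nu>. w_char \<nu> \<rho>' x * cnj (w_char \<nu> \<rho> x)) / 2 ^ \<nu>) (w_vec \<nu> \<rho> m)"
  proof (rule poly_mapping_eqI)
    fix c
    have "keys (w_prod \<nu> \<rho>') \<subseteq> lat2_below \<nu>"
      unfolding lat2_below_def by (rule subsetI) (simp add: in_keys_iff lookup_w_prod split: if_splits)
    then show "lookup (lin_ext (\<lambda>x. pm_scale (cnj (w_char \<nu> \<rho> x) / 2 ^ \<nu>) (w_vec \<nu> \<rho> m)) (w_prod \<nu> \<rho>')) c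
      = lookup (pm_scale ((\<Sum>x\<in>lat2_below \<nu>. w_char \<nu> \<rho>' x * cnj (w_char \<nu> \<rho> x)) / 2 ^ \<nu>) (w_vec \<nu> \<rho> m)) c"
      by (subst lookup_lin_ext_superset[OF finite_lat2_below])
         (simp_all add: sum_divide_distrib sum_distrib_right lookup_w_prod,
          simp_all add: lat2_below_def mult.assoc)
  qed
  finally show ?thesis using assms by (simp add: w_char_orthogonal)
qed

lemma sum_w_proj:
  assumes "v \<in> Fock \<nu>"
  shows "(\<Sum>\<rho>\<in>sign_vectors \<nu>. w_proj \<nu> \<rho> v) = v"
proof -
  have "(\<Sum>\<rho>\<in>sign_vectors \<nu>. w_proj \<nu> \<rho> v)
      = lin_ext (\<lambda>b. \<Sum>\<rho>\<in>sign_vectors \<nu>. case b of (x, m) \<Rightarrow> pm_scale (cnj (w_char \<nu> \<rho> x) / 2 ^ \<nu>) (w_vec \<nu> \<rho> m)) v"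
    by (simp add: w_proj_def lin_ext_fun_sum)
  also have "\<dots> = lin_ext (\<lambda>b. Poly_Mapping.single b 1) v"
  proof (rule lin_ext_cong, rule poly_mapping_eqI)
    fix b c :: "lat2 \<times> mono" assume "b \<in> keys v"
    obtain x m y m' where b: "b = (x, m)" and c: "c = (y, m')" by (cases b, cases c)
    have x: "x \<in> lat2_below \<nu>" using assms \<open>b \<in> keys v\<close> by (auto simp: Fock_alt b)
    have "lookup (\<Sum>\<rho>\<in>sign_vectors \<nu>. pm_scale (cnj (w_char \<nu> \<rho> x) / 2 ^ \<nu>) (w_vec \<nu> \<rho> m)) (y, m')
      = (if m' = m \<and> y \<in> lat2_below \<nu> then (\<Sum>\<rho>\<in>sign_vectors \<nu>. w_char \<nu> \<rho> y * cnj (w_char \<nu> \<rho> x)) / 2 ^ \<nu> else 0)"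
      by (cases "m' = m \<and> y \<in> lat2_below \<nu>")
         (simp_all only: lookup_sum lookup_pm_scale lookup_w_vec if_True if_False sum_divide_distrib,
          simp_all add: mult.commute)
    also have "\<dots> = lookup (Poly_Mapping.single (x, m) 1) (y, m')"
      using x by (auto simp: w_char_complete lookup_single when_def)
    finally show "lookup (\<Sum>\<rho>\<in>sign_vectors \<nu>. case b of (x, m) \<Rightarrow> pm_scale (cnj (w_char \<nu> \<rho> x) / 2 ^ \<nu>) (w_vec \<nu> \<rho> m)) c
      = lookup (Poly_Mapping.single b 1) c"
      by (simp add: b c)
  qed
  finally show ?thesis by (simp add: lin_ext_of_singles)
qed

section \<open>The Clifford generators on the vectors w\<close>

definition flip_signs :: "nat \<Rightarrow> (nat \<Rightarrow> int) \<Rightarrow> nat \<Rightarrow> int" where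
  "flip_signs i \<rho> = (\<lambda>l. if l < i \<or> (l = i \<and> odd i) then - \<rho> l else \<rho> l)"

lemma flip_signs_signs: "\<rho> \<in> {1..\<nu>} \<rightarrow> {1, -1} \<Longrightarrow> flip_signs i \<rho> \<in> {1..\<nu>} \<rightarrow> {1, -1}"
  by (fastforce simp: flip_signs_def Pi_iff)

lemma lookup_grp_op:
  "lookup (grp_op x v) (y, m) = cocyc (rep x) (rep (x + y)) * lookup v (x + y, m)"
proof -
  have "lookup (grp_op x v) (y, m)
      = (\<Sum>b\<in>keys v. if b = (x + y, m) then cocyc (rep x) (rep (x + y)) * lookup v (x + y, m) else 0)"
    unfolding grp_op_def lookup_lin_ext
  proof (intro sum.cong refl)
    fix b assume "b \<in> keys v"
    obtain z l where b: "b = (z, l)" by (cases b)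
    have "x + z = y \<longleftrightarrow> z = x + y" by (metis lat2_add_cancel(1))
    then show "lookup v b * lookup (case b of (z, l) \<Rightarrow> Poly_Mapping.single (x + z, l) (cocyc (rep x) (rep z))) (y, m)
      = (if b = (x + y, m) then cocyc (rep x) (rep (x + y)) * lookup v (x + y, m) else 0)"
      by (auto simp: b lookup_single when_def)
  qed
  also have "\<dots> = cocyc (rep x) (rep (x + y)) * lookup v (x + y, m)" by (auto simp: in_keys_iff)
  finally show ?thesis .
qed

lemma cocyc_eps_rep:
  assumes "y \<in> lat2_below \<nu>"
  shows "cocyc (eps i) (rep y) = (\<Prod>l\<in>{1..\<nu>}. if l < i \<and> lookup y l \<noteq> 0 then -1 else 1)"
proof -
  have "cocyc (eps i) (rep y) = (\<Prod>k\<in>{i}. \<Prod>l\<in>{1..\<nu>}.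
      if k \<le> l then 1 else (-1) powi (lookup (eps i) k * lookup (rep y) l))"
    using assms by (intro cocyc_superset) (auto simp: eps_def keys_rep lat2_below_def)
  also have "\<dots> = (\<Prod>l\<in>{1..\<nu>}. if l < i \<and> lookup y l \<noteq> 0 then -1 else 1)"
    by (auto simp: eps_def lookup_rep intro!: prod.cong)
  finally show ?thesis .
qed

text \<open>
  Moving \<open>e_i\<close> to its place in \<open>w(\<rho>)\<close> changes the sign of every \<open>e_l\<close> with \<open>l < i\<close>. There it
  meets \<open>1 + c e_i\<close>, and \<open>e_i (1 + c e_i) = c (1 + c\<^sup>-\<^sup>1 e_i)\<close>; the inverse of \<open>c\<close> is \<open>c\<close> for even
  \<open>i\<close> (\<open>c = \<plusminus>1\<close>) and \<open>-c\<close> for odd \<open>i\<close> (\<open>c = \<plusminus>\<i>\<close>), whence the extra sign change for odd \<open>i\<close>.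
\<close>

lemma grp_op_eps_w_vec:
  assumes "i \<in> {1..\<nu>}" "\<rho> \<in> {1..\<nu>} \<rightarrow> {1, -1}"
  shows "grp_op (cls (eps i)) (w_vec \<nu> \<rho> m)
    = pm_scale (w_const i * of_int (\<rho> i)) (w_vec \<nu> (flip_signs i \<rho>) m)"
proof (rule poly_mapping_eqI, clarify)
  fix y m'
  let ?z = "cls (eps i) + y"
  have z: "?z \<in> lat2_below \<nu> \<longleftrightarrow> y \<in> lat2_below \<nu>"
    using assms(1)
    by (cases "i \<in> keys y") (auto simp only: lat2_below_def cls_eps add.commute[of _ y]
        keys_add_single_lat2 mem_Collect_eq if_True if_False)
  have lz: "lookup ?z l = (if l = i then lookup y l + 1 else lookup y l)" for l
    by (simp add: cls_eps lookup_add lookup_single when_def add.commute del: add_bit_eq_xor)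
  have "cocyc (eps i) (rep ?z) * w_char \<nu> \<rho> ?z
      = w_const i * of_int (\<rho> i) * w_char \<nu> (flip_signs i \<rho>) y" if y: "y \<in> lat2_below \<nu>"
  proof -
    have "cocyc (eps i) (rep ?z) * w_char \<nu> \<rho> ?z
        = (\<Prod>l\<in>{1..\<nu>}. (if l < i \<and> lookup ?z l \<noteq> 0 then -1 else 1)
          * (if lookup ?z l = 0 then 1 else w_const l * of_int (\<rho> l)))"
      using y z cocyc_eps_rep[of ?z \<nu> i] by (simp only: w_char_def prod.distrib simp_thms)
    also have "\<dots> = (\<Prod>l\<in>{1..\<nu>}. (if l = i then w_const i * of_int (\<rho> i) else 1)
          * (if lookup y l = 0 then 1 else w_const l * of_int (flip_signs i \<rho> l)))"
    proof (intro prod.cong refl)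
      fix l
      \<comment> \<open>the identity holds factor by factor; the scalar in front is absorbed in the factor
         with index \<open>i\<close>\<close>
      have "\<rho> i = 1 \<or> \<rho> i = -1" using assms by blast
      then show "(if l < i \<and> lookup ?z l \<noteq> 0 then -1 else 1)
          * (if lookup ?z l = 0 then 1 else w_const l * of_int (\<rho> l))
        = (if l = i then w_const i * of_int (\<rho> i) else 1)
          * (if lookup y l = 0 then 1 else w_const l * of_int (flip_signs i \<rho> l))"
        using bit_cases[of "lookup y l"]
        by (cases l i rule: linorder_cases; elim disjE)
           (simp_all add: lz flip_signs_def w_const_def del: add_bit_eq_xor)
    qed
    also have "\<dots> = w_const i * of_int (\<rho> i) * w_char \<nu> (flip_signs i \<rho>) y"
      unfolding prod.distrib w_char_def using assms(1) by (subst prod.delta) simp_all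
    finally show ?thesis .
  qed
  moreover have "cocyc (rep (cls (eps i))) (rep ?z) = cocyc (eps i) (rep ?z)"
    by (rule cocyc_cls) simp_all
  ultimately show "lookup (grp_op (cls (eps i)) (w_vec \<nu> \<rho> m)) (y, m') =
      lookup (pm_scale (w_const i * of_int (\<rho> i)) (w_vec \<nu> (flip_signs i \<rho>) m)) (y, m')"
    by (simp add: lookup_grp_op lookup_w_vec z)
qed

lemma grp_op_grp_op:
  "grp_op (cls \<alpha>) (grp_op (cls \<beta>) v) = pm_scale (cocyc \<alpha> \<beta>) (grp_op (cls (\<alpha> + \<beta>)) v)"
proof (rule poly_mapping_eqI, clarify)
  fix y m
  let ?z = "cls \<alpha> + cls \<beta> + y"
  have "cocyc (rep (cls \<alpha>)) (rep (cls \<alpha> + y)) = cocyc \<alpha> (\<beta> + rep ?z)"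
    by (rule cocyc_cls) (simp_all add: cls_add algebra_simps)
  moreover have "cocyc (rep (cls \<beta>)) (rep ?z) = cocyc \<beta> (rep ?z)"
    "cocyc (rep (cls (\<alpha> + \<beta>))) (rep ?z) = cocyc (\<alpha> + \<beta>) (rep ?z)"
    by (rule cocyc_cls; simp)+
  ultimately show "lookup (grp_op (cls \<alpha>) (grp_op (cls \<beta>) v)) (y, m)
      = lookup (pm_scale (cocyc \<alpha> \<beta>) (grp_op (cls (\<alpha> + \<beta>)) v)) (y, m)"
    by (simp add: lookup_grp_op cls_add cocyc_add_left cocyc_add_right)
       (simp add: add.assoc add.commute add.left_commute)
qed

lemma grp_op_eps_diff:
  "pm_scale (cocyc (eps i) (eps j)) (grp_op (cls (eps i - eps j)) v)
    = grp_op (cls (eps i)) (grp_op (cls (eps j)) v)"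
  by (simp add: grp_op_grp_op cls_diff)

section \<open>The blocks of the Fock space\<close>

text \<open>
  The label \<open>\<gamma>\<close> of the block that contains \<open>w(\<rho>)\<close>. With the convention \<open>\<rho>\<^sub>\<nu>\<^sub>+\<^sub>1 = 1\<close> the last
  condition for even \<open>\<nu>\<close> has the same form \<open>\<rho>\<^sub>2\<^sub>j \<rho>\<^sub>2\<^sub>j\<^sub>+\<^sub>1 = \<gamma>\<^sub>j\<^sub>+\<^sub>1\<close> as the others, so that both
  parities of \<open>\<nu>\<close> are treated at once.
\<close>

definition sign_class :: "nat \<Rightarrow> (nat \<Rightarrow> int) \<Rightarrow> nat \<Rightarrow> int" where
  "sign_class \<nu> \<rho> = (\<lambda>k\<in>{1..\<nu> div 2 + 1}. if k = 1 then \<rho> 1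
     else \<rho> (2 * (k - 1)) * (if 2 * k - 1 \<le> \<nu> then \<rho> (2 * k - 1) else 1))"

definition fock_block :: "nat \<Rightarrow> (nat \<Rightarrow> int) \<Rightarrow> fock set" where
  "fock_block \<nu> \<gamma> = module.span pm_scale
     {w_vec \<nu> \<rho> m | \<rho> m. \<rho> \<in> {1..\<nu>} \<rightarrow> {1, -1} \<and> sign_class \<nu> \<rho> = \<gamma> \<and> m \<in> neg_odd_monos \<nu>}"

lemma pair_index_range:
  fixes k \<nu> :: nat
  assumes "k \<in> {1..\<nu> div 2 + 1}" "k \<noteq> 1"
  shows "2 * (k - 1) \<in> {1..\<nu>}"
proof -
  have "k - 1 \<le> \<nu> div 2" "1 \<le> k - 1" using assms by auto
  then show ?thesis unfolding atLeastAtMost_iff by linarith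
qed

lemma sign_class_cong:
  assumes "\<And>j. j \<in> {1..\<nu>} \<Longrightarrow> \<rho> j = \<rho>' j" "1 \<le> \<nu>"
  shows "sign_class \<nu> \<rho> = sign_class \<nu> \<rho>'"
  unfolding sign_class_def
proof (rule restrict_ext)
  fix k assume k: "k \<in> {1..\<nu> div 2 + 1}"
  have "\<rho> (2 * (k - 1)) = \<rho>' (2 * (k - 1))" if "k \<noteq> 1"
    using pair_index_range[OF k that] by (rule assms)
  moreover have "\<rho> (2 * k - 1) = \<rho>' (2 * k - 1)" if "2 * k - 1 \<le> \<nu>"
  proof (rule assms)
    have "1 \<le> 2 * k - 1" using k unfolding atLeastAtMost_iff by arith
    with that show "2 * k - 1 \<in> {1..\<nu>}" by simp
  qed
  ultimately show "(if k = 1 then \<rho> 1 else \<rho> (2 * (k - 1)) * (if 2 * k - 1 \<le> \<nu> then \<rho> (2 * k - 1) else 1))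
    = (if k = 1 then \<rho>' 1 else \<rho>' (2 * (k - 1)) * (if 2 * k - 1 \<le> \<nu> then \<rho>' (2 * k - 1) else 1))"
    using assms(1)[of 1] assms(2) by simp
qed

lemma sign_class_in:
  assumes "\<rho> \<in> {1..\<nu>} \<rightarrow> {1, -1}" "1 \<le> \<nu>"
  shows "sign_class \<nu> \<rho> \<in> {1..\<nu> div 2 + 1} \<rightarrow>\<^sub>E {1, -1}"
proof -
  have sg: "\<rho> j = 1 \<or> \<rho> j = -1" if "1 \<le> j" "j \<le> \<nu>" for j using assms that by auto
  show ?thesis
    unfolding sign_class_def
  proof (rule restrict_PiE_iff[THEN iffD2], intro ballI)
    fix k assume k: "k \<in> {1..\<nu> div 2 + 1}"
    show "(if k = 1 then \<rho> 1 else \<rho> (2 * (k - 1)) * (if 2 * k - 1 \<le> \<nu> then \<rho> (2 * k - 1) else 1)) \<in> {1, -1}"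
    proof (cases "k = 1")
      case True
      then show ?thesis using sg[of 1] assms(2) by simp
    next
      case False
      have "\<rho> (2 * (k - 1)) = 1 \<or> \<rho> (2 * (k - 1)) = -1"
        using pair_index_range[OF k False] sg by simp
      moreover have "\<rho> (2 * k - 1) = 1 \<or> \<rho> (2 * k - 1) = -1" if "2 * k - 1 \<le> \<nu>"
      proof (rule sg[OF _ that])
        show "1 \<le> 2 * k - 1" using k unfolding atLeastAtMost_iff by arith
      qed
      ultimately show ?thesis using False by auto
    qed
  qed
qed

lemma flip_signs_last: "2 * k - 1 > \<nu> \<Longrightarrow> k \<noteq> 0 \<Longrightarrow> i \<le> \<nu> \<Longrightarrow> flip_signs i \<rho> (2 * (k - 1)) = \<rho> (2 * (k - 1))"
  by (auto simp: flip_signs_def)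

lemma flip_signs_pair: "1 < k \<Longrightarrow> flip_signs i \<rho> (2 * (k - 1)) * flip_signs i \<rho> (2 * k - 1)
    = \<rho> (2 * (k - 1)) * \<rho> (2 * k - 1)"
proof -
  assume "1 < k"
  then obtain l where k: "k = Suc l" by (cases k) auto
  have "2 * l < i \<longleftrightarrow> 2 * l + 1 < i \<or> 2 * l + 1 = i" by auto
  then show ?thesis by (auto simp: k flip_signs_def)
qed

text \<open>
  Each \<open>flip_signs i\<close> negates \<open>\<rho>\<^sub>1\<close>, negates both or none of \<open>\<rho>\<^sub>2\<^sub>k, \<rho>\<^sub>2\<^sub>k\<^sub>+\<^sub>1\<close>, and never negates
  \<open>\<rho>\<^sub>\<nu>\<close> for even \<open>\<nu>\<close>; so it changes only the first entry of the class, and two of them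
  change nothing.
\<close>

lemma sign_class_flip_flip:
  assumes "i \<in> {1..\<nu>}" "j \<in> {1..\<nu>}"
  shows "sign_class \<nu> (flip_signs i (flip_signs j \<rho>)) = sign_class \<nu> \<rho>"
  unfolding sign_class_def
proof (rule restrict_ext)
  fix k assume k: "k \<in> {1..\<nu> div 2 + 1}"
  have one: "flip_signs i \<rho> 1 = - \<rho> 1" if "i \<in> {1..\<nu>}" for i \<rho>
    using that by (auto simp: flip_signs_def)
  show "(if k = 1 then flip_signs i (flip_signs j \<rho>) 1 else flip_signs i (flip_signs j \<rho>) (2 * (k - 1))
        * (if 2 * k - 1 \<le> \<nu> then flip_signs i (flip_signs j \<rho>) (2 * k - 1) else 1))
      = (if k = 1 then \<rho> 1 else \<rho> (2 * (k - 1)) * (if 2 * k - 1 \<le> \<nu> then \<rho> (2 * k - 1) else 1))"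
  proof (cases "k = 1")
    case True
    then show ?thesis using one assms by simp
  next
    case False
    then have "1 < k" using k by simp
    show ?thesis
    proof (cases "2 * k - 1 \<le> \<nu>")
      case True
      then show ?thesis using \<open>1 < k\<close> by (simp only: flip_signs_pair if_True False if_False)
    next
      case 2: False
      then have "2 * k - 1 > \<nu>" "k \<noteq> 0" using \<open>1 < k\<close> by auto
      then show ?thesis
        using assms False 2 flip_signs_last[of \<nu> k i] flip_signs_last[of \<nu> k j] by auto
    qed
  qed
qed

lemma V_space_alt:
  assumes "2 \<le> \<nu>" "\<gamma> \<in> {1..\<nu> div 2 + 1} \<rightarrow>\<^sub>E {1, -1}"
  shows "V_space \<nu> \<gamma> = module.span pm_scale
    {w_prod \<nu> \<rho> | \<rho>. \<rho> \<in> {1..\<nu>} \<rightarrow> {1, -1} \<and> sign_class \<nu> \<rho> = \<gamma>}"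
proof -
  define d where "d = \<nu> div 2"
  have "d \<ge> 1" using assms(1) by (simp add: d_def)
  let ?c = "\<lambda>\<rho> k. if k = 1 then \<rho> 1
     else \<rho> (2 * (k - 1)) * (if 2 * k - 1 \<le> \<nu> then \<rho> (2 * k - 1) else 1 :: int)"
  have ball_image_Suc: "(\<forall>k\<in>insert 1 (Suc ` A). Q k) \<longleftrightarrow> Q 1 \<and> (\<forall>j\<in>A. Q (Suc j))" for A Q
    by blast
  have cond: "sign_class \<nu> \<rho> = \<gamma> \<longleftrightarrow> \<rho> 1 = \<gamma> 1 \<and>
       (if odd \<nu> then \<forall>j\<in>{1..d}. \<rho> (2 * j) * \<rho> (2 * j + 1) = \<gamma> (j + 1)
        else (\<forall>j\<in>{1..d - 1}. \<rho> (2 * j) * \<rho> (2 * j + 1) = \<gamma> (j + 1)) \<and>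
             \<rho> (2 * d) = \<gamma> (d + 1))" for \<rho>
  proof -
    have "sign_class \<nu> \<rho> = \<gamma> \<longleftrightarrow> (\<forall>k\<in>{1..d + 1}. ?c \<rho> k = \<gamma> k)"
      using assms(2) unfolding sign_class_def d_def fun_eq_iff restrict_def PiE_def extensional_def
      by (auto split: if_splits)
    also have "{1..d + 1} = insert 1 (Suc ` {1..d})" by (auto simp: image_iff)
    also have "(\<forall>k\<in>insert 1 (Suc ` {1..d}). ?c \<rho> k = \<gamma> k) \<longleftrightarrow> \<rho> 1 = \<gamma> 1 \<and>
        (\<forall>j\<in>{1..d}. \<rho> (2 * j) * (if 2 * j + 1 \<le> \<nu> then \<rho> (2 * j + 1) else 1) = \<gamma> (j + 1))"
      unfolding ball_image_Suc by simp
    also have "(\<forall>j\<in>{1..d}. \<rho> (2 * j) * (if 2 * j + 1 \<le> \<nu> then \<rho> (2 * j + 1) else 1) = \<gamma> (j + 1))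
       \<longleftrightarrow> (if odd \<nu> then \<forall>j\<in>{1..d}. \<rho> (2 * j) * \<rho> (2 * j + 1) = \<gamma> (j + 1)
        else (\<forall>j\<in>{1..d - 1}. \<rho> (2 * j) * \<rho> (2 * j + 1) = \<gamma> (j + 1)) \<and>
             \<rho> (2 * d) = \<gamma> (d + 1))"
    proof (cases "odd \<nu>")
      case True
      then have "2 * j + 1 \<le> \<nu>" if "j \<in> {1..d}" for j
        using that True unfolding d_def atLeastAtMost_iff by presburger
      then show ?thesis using True by simp
    next
      case False
      then have \<nu>: "\<nu> = 2 * d" by (simp add: d_def)
      have "{1..d} = insert d {1..d - 1}" using \<open>d \<ge> 1\<close> by auto
      moreover have "2 * j + 1 \<le> \<nu>" if "j \<in> {1..d - 1}" for j
        using that unfolding \<nu> by auto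
      ultimately show ?thesis using False by (auto simp: \<nu>)
    qed
    finally show ?thesis .
  qed
  show ?thesis
    unfolding V_space_def Let_def d_def[symmetric] cond Pi_iff by (simp only: conj_assoc)
qed

lemma tensor_as_sum:
  "tensor u p = (\<Sum>m\<in>keys p. pm_scale (lookup p m) (lin_ext (\<lambda>x. Poly_Mapping.single (x, m) 1) u))"
  unfolding tensor_def
  by (subst lin_ext_def[of _ p]) (simp add: lin_ext_fun_sum lin_ext_fun_scale)

lemma w_vec_in_fock_block:
  "\<rho> \<in> {1..\<nu>} \<rightarrow> {1, -1} \<Longrightarrow> m \<in> neg_odd_monos \<nu> \<Longrightarrow> w_vec \<nu> \<rho> m \<in> fock_block \<nu> (sign_class \<nu> \<rho>)"
  unfolding fock_block_def by (rule pm.span_base) blast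

lemma tensor_space_eq_block:
  assumes "2 \<le> \<nu>" "\<gamma> \<in> {1..\<nu> div 2 + 1} \<rightarrow>\<^sub>E {1, -1}"
  shows "tensor_space (V_space \<nu> \<gamma>) (Sym \<nu>) = fock_block \<nu> \<gamma>"
proof
  show "fock_block \<nu> \<gamma> \<subseteq> tensor_space (V_space \<nu> \<gamma>) (Sym \<nu>)"
    unfolding fock_block_def tensor_space_def
  proof (rule pm.span_mono, clarify)
    fix \<rho> m assume "\<rho> \<in> {1..\<nu>} \<rightarrow> {1, -1}" "m \<in> neg_odd_monos \<nu>" "\<gamma> = sign_class \<nu> \<rho>"
    then show "\<exists>u p. w_vec \<nu> \<rho> m = tensor u p \<and> u \<in> V_space \<nu> (sign_class \<nu> \<rho>) \<and> p \<in> Sym \<nu>"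
      using assms V_space_alt[of \<nu> \<gamma>]
      by (intro exI[of _ "w_prod \<nu> \<rho>"] exI[of _ "Poly_Mapping.single m 1"])
         (auto simp: w_vec_def Sym_alt intro!: pm.span_base)
  qed
  have sub: "module.subspace pm_scale (fock_block \<nu> \<gamma>)"
    unfolding fock_block_def by (rule pm.subspace_span)
  show "tensor_space (V_space \<nu> \<gamma>) (Sym \<nu>) \<subseteq> fock_block \<nu> \<gamma>"
    unfolding tensor_space_def
  proof (rule pm.span_minimal[OF _ sub], clarify)
    fix u p assume u: "u \<in> V_space \<nu> \<gamma>" and p: "p \<in> Sym \<nu>"
    have "lin_ext (\<lambda>x. Poly_Mapping.single (x, m) 1) u \<in> fock_block \<nu> \<gamma>" if "m \<in> keys p" for m
    proof -
      have m: "m \<in> neg_odd_monos \<nu>" using p that by (auto simp: Sym_alt)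
      have "V_space \<nu> \<gamma> \<subseteq> {u. lin_ext (\<lambda>x. Poly_Mapping.single (x, m) 1) u \<in> fock_block \<nu> \<gamma>}"
        unfolding V_space_alt[OF assms]
        using m by (intro pm.span_minimal subspace_vimage_lin_ext sub)
          (use w_vec_in_fock_block in \<open>auto simp: w_vec_alt[symmetric]\<close>)
      then show ?thesis using u by blast
    qed
    then show "tensor u p \<in> fock_block \<nu> \<gamma>"
      unfolding tensor_as_sum by (intro pm.subspace_sum pm.subspace_scale sub)
  qed
qed

section \<open>Decomposition into blocks\<close>

text \<open>
  Applying the projections to a decomposition recovers its components, whence uniqueness. The
  index type is arbitrary because the decomposition is needed both indexed by \<open>\<gamma>\<close> and indexed by
  the set of blocks itself, the form in which complete reducibility is defined.
\<close>

lemma direct_sum_if_projections: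
  fixes P :: "'i \<Rightarrow> 'v::ab_group_add \<Rightarrow> 'v"
  assumes "finite I"
    and W: "\<And>i. i \<in> I \<Longrightarrow> W i \<subseteq> V"
    and P_in: "\<And>i v. i \<in> I \<Longrightarrow> v \<in> V \<Longrightarrow> P i v \<in> W i"
    and P_sum: "\<And>v. v \<in> V \<Longrightarrow> (\<Sum>i\<in>I. P i v) = v"
    and P_add: "\<And>i u v. P i (u + v) = P i u + P i v"
    and P_W: "\<And>i j w. i \<in> I \<Longrightarrow> j \<in> I \<Longrightarrow> w \<in> W j \<Longrightarrow> P i w = (if i = j then w else 0)"
  shows "direct_sum I W V"
  unfolding direct_sum_def
proof (intro conjI ballI)
  fix i assume "i \<in> I" then show "W i \<subseteq> V" by (rule W)
next
  fix v assume v: "v \<in> V"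
  have P_0: "P i 0 = 0" for i using P_add[of i 0 0] by simp
  have P_sum': "P i (sum f A) = (\<Sum>a\<in>A. P i (f a))" for i A and f :: "'i \<Rightarrow> 'v"
    by (induction A rule: infinite_finite_induct) (simp_all add: P_0 P_add)
  let ?f = "\<lambda>i. if i \<in> I then P i v else 0"
  show "\<exists>!f. (\<forall>i\<in>I. f i \<in> W i) \<and> (\<forall>i. i \<notin> I \<longrightarrow> f i = 0) \<and>
      finite {i. f i \<noteq> 0} \<and> v = (\<Sum>i | f i \<noteq> 0. f i)"
  proof (rule ex1I[of _ ?f])
    have sub: "{i. ?f i \<noteq> 0} \<subseteq> I" by auto
    have "(\<Sum>i | ?f i \<noteq> 0. ?f i) = (\<Sum>i\<in>I. ?f i)"
      using \<open>finite I\<close> by (intro sum.mono_neutral_left) auto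
    also have "\<dots> = v" using P_sum[OF v] by simp
    finally show "(\<forall>i\<in>I. ?f i \<in> W i) \<and> (\<forall>i. i \<notin> I \<longrightarrow> ?f i = 0) \<and>
      finite {i. ?f i \<noteq> 0} \<and> v = (\<Sum>i | ?f i \<noteq> 0. ?f i)"
      using P_in v finite_subset[OF sub \<open>finite I\<close>] by auto
  next
    fix f assume f: "(\<forall>i\<in>I. f i \<in> W i) \<and> (\<forall>i. i \<notin> I \<longrightarrow> f i = 0) \<and>
      finite {i. f i \<noteq> 0} \<and> v = (\<Sum>i | f i \<noteq> 0. f i)"
    show "f = ?f"
    proof
      fix i
      show "f i = ?f i"
      proof (cases "i \<in> I")
        case True
        have "P i v = (\<Sum>j | f j \<noteq> 0. P i (f j))" using f P_sum' by metis
        also have "\<dots> = (\<Sum>j | f j \<noteq> 0. if i = j then f j else 0)"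
          using f True by (intro sum.cong refl) (metis (mono_tags, lifting) P_W mem_Collect_eq)
        also have "\<dots> = f i" using f by simp
        finally show ?thesis using True by simp
      qed (use f in simp)
    qed
  qed
qed

lemma subspace_fock_block: "module.subspace pm_scale (fock_block \<nu> \<gamma>)"
  unfolding fock_block_def by (rule pm.subspace_span)

lemma fock_block_induct:
  assumes "v \<in> fock_block \<nu> \<gamma>" "module.subspace pm_scale S"
    and "\<And>\<rho> m. \<rho> \<in> {1..\<nu>} \<rightarrow> {1, -1} \<Longrightarrow> sign_class \<nu> \<rho> = \<gamma> \<Longrightarrow> m \<in> neg_odd_monos \<nu> \<Longrightarrow> w_vec \<nu> \<rho> m \<in> S"
  shows "v \<in> S"
proof -
  have "fock_block \<nu> \<gamma> \<subseteq> S"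
    unfolding fock_block_def using assms by (intro pm.span_minimal) auto
  with assms(1) show ?thesis by blast
qed

lemma fock_block_Fock: "fock_block \<nu> \<gamma> \<subseteq> Fock \<nu>"
  using fock_block_induct[OF _ subspace_Fock] w_vec_in_Fock by blast

definition block_proj :: "nat \<Rightarrow> (nat \<Rightarrow> int) \<Rightarrow> fock \<Rightarrow> fock" where
  "block_proj \<nu> \<gamma> v = (\<Sum>\<rho> | \<rho> \<in> sign_vectors \<nu> \<and> sign_class \<nu> \<rho> = \<gamma>. w_proj \<nu> \<rho> v)"

lemma w_proj_add: "w_proj \<nu> \<rho> (u + v) = w_proj \<nu> \<rho> u + w_proj \<nu> \<rho> v"
  by (simp add: w_proj_def lin_ext_add)

lemma w_proj_scale: "w_proj \<nu> \<rho> (pm_scale c v) = pm_scale c (w_proj \<nu> \<rho> v)"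
  by (simp add: w_proj_def lin_ext_scale)

lemma w_proj_in_block:
  assumes "\<rho> \<in> sign_vectors \<nu>" "v \<in> Fock \<nu>"
  shows "w_proj \<nu> \<rho> v \<in> fock_block \<nu> (sign_class \<nu> \<rho>)"
  unfolding w_proj_def using assms
  by (intro subspace_lin_ext subspace_fock_block)
     (auto simp: Fock_alt sign_vectors_def PiE_def
       intro!: pm.subspace_scale subspace_fock_block w_vec_in_fock_block)

lemma block_proj_block:
  assumes "1 \<le> \<nu>" "w \<in> fock_block \<nu> \<gamma>'"
  shows "block_proj \<nu> \<gamma> w = (if \<gamma> = \<gamma>' then w else 0)"
proof -
  have "w \<in> {w. block_proj \<nu> \<gamma> w = pm_scale (if \<gamma> = \<gamma>' then 1 else 0) w}"
    using assms(2)
  proof (rule fock_block_induct)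
    show "module.subspace pm_scale {w. block_proj \<nu> \<gamma> w = pm_scale (if \<gamma> = \<gamma>' then 1 else 0) w}"
      unfolding pm.subspace_def
      by (simp add: block_proj_def w_proj_add w_proj_scale sum.distrib pm.scale_right_distrib
          pm.scale_sum_right[symmetric] mult.commute) (simp add: w_proj_def)
    fix \<rho>' m assume \<rho>': "\<rho>' \<in> {1..\<nu>} \<rightarrow> {1, -1}" "sign_class \<nu> \<rho>' = \<gamma>'" "m \<in> neg_odd_monos \<nu>"
    let ?r = "restrict \<rho>' {1..\<nu>}"
    have r: "?r \<in> sign_vectors \<nu>" using \<rho>' by (auto simp: sign_vectors_def)
    have cl: "sign_class \<nu> ?r = \<gamma>'" using sign_class_cong[of \<nu> ?r \<rho>'] \<rho>' assms(1) by auto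
    have "w_proj \<nu> \<rho> (w_vec \<nu> \<rho>' m) = (if \<rho> = ?r then w_vec \<nu> \<rho>' m else 0)"
      if "\<rho> \<in> sign_vectors \<nu>" for \<rho>
    proof -
      have "(\<forall>j\<in>{1..\<nu>}. \<rho>' j = \<rho> j) \<longleftrightarrow> \<rho> = ?r"
        using that by (auto simp: sign_vectors_def PiE_def extensional_def fun_eq_iff)
      moreover have "w_vec \<nu> ?r m = w_vec \<nu> \<rho>' m" by (rule w_vec_cong) auto
      ultimately show ?thesis
        using that \<rho>' by (subst w_proj_w_vec) (auto simp: sign_vectors_def PiE_def)
    qed
    then have "block_proj \<nu> \<gamma> (w_vec \<nu> \<rho>' m)
        = (\<Sum>\<rho> | \<rho> \<in> sign_vectors \<nu> \<and> sign_class \<nu> \<rho> = \<gamma>. if \<rho> = ?r then w_vec \<nu> \<rho>' m else 0)"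
      by (simp add: block_proj_def)
    also have "\<dots> = (if \<gamma> = \<gamma>' then w_vec \<nu> \<rho>' m else 0)"
      using r cl finite_sign_vectors[of \<nu>] by auto
    finally show "w_vec \<nu> \<rho>' m \<in> {w. block_proj \<nu> \<gamma> w = pm_scale (if \<gamma> = \<gamma>' then 1 else 0) w}"
      by simp
  qed
  then show ?thesis by simp
qed

lemma block_proj_in:
  assumes "v \<in> Fock \<nu>"
  shows "block_proj \<nu> \<gamma> v \<in> fock_block \<nu> \<gamma>"
  unfolding block_proj_def using assms w_proj_in_block
  by (intro pm.subspace_sum subspace_fock_block) auto

lemma sum_block_proj:
  assumes "1 \<le> \<nu>" "v \<in> Fock \<nu>"
  shows "(\<Sum>\<gamma>\<in>{1..\<nu> div 2 + 1} \<rightarrow>\<^sub>E {1, -1}. block_proj \<nu> \<gamma> v) = v"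
proof -
  have "(\<Sum>\<gamma>\<in>{1..\<nu> div 2 + 1} \<rightarrow>\<^sub>E {1, -1}. block_proj \<nu> \<gamma> v) = (\<Sum>\<rho>\<in>sign_vectors \<nu>. w_proj \<nu> \<rho> v)"
    unfolding block_proj_def
  proof (rule sum.group)
    show "sign_class \<nu> ` sign_vectors \<nu> \<subseteq> {1..\<nu> div 2 + 1} \<rightarrow>\<^sub>E {1, -1}"
      using assms(1) by (intro image_subsetI sign_class_in) (auto simp only: sign_vectors_def PiE_def)
  qed (auto simp: finite_sign_vectors intro!: finite_PiE)
  then show ?thesis using sum_w_proj[OF assms(2)] by simp
qed

lemma block_nonzero:
  assumes "\<gamma> \<in> {1..\<nu> div 2 + 1} \<rightarrow>\<^sub>E {1, -1}"
  shows "\<exists>v\<in>fock_block \<nu> \<gamma>. v \<noteq> 0"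
proof -
  \<comment> \<open>a sign vector of class \<open>\<gamma>\<close>: all the odd entries after the first are 1\<close>
  define \<rho> where "\<rho> l = (if l = 1 then \<gamma> 1 else if even l then \<gamma> (l div 2 + 1) else 1)" for l
  have "\<rho> \<in> {1..\<nu>} \<rightarrow> {1, -1}"
  proof
    fix l assume "l \<in> {1..\<nu>}"
    then have "1 \<in> {1..\<nu> div 2 + 1}" "l div 2 + 1 \<in> {1..\<nu> div 2 + 1}" by (auto simp: div_le_mono)
    then have "\<gamma> 1 \<in> {1, -1}" "\<gamma> (l div 2 + 1) \<in> {1, -1}" using assms by blast+
    then show "\<rho> l \<in> {1, -1}" unfolding \<rho>_def by (simp split: if_split)
  qed
  moreover have "sign_class \<nu> \<rho> = \<gamma>"
  proof
    fix k show "sign_class \<nu> \<rho> k = \<gamma> k"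
    proof (cases "k \<in> {1..\<nu> div 2 + 1}")
      case True
      then show ?thesis by (cases k) (auto simp: sign_class_def \<rho>_def)
    next
      case False
      then show ?thesis using assms by (auto simp: sign_class_def PiE_def extensional_def)
    qed
  qed
  moreover have "0 \<in> neg_odd_monos \<nu>" by (simp add: neg_odd_monos_def)
  ultimately show ?thesis using w_vec_in_fock_block w_vec_nonzero by blast
qed

lemma direct_sum_blocks:
  assumes "1 \<le> \<nu>"
  shows "direct_sum ({1..\<nu> div 2 + 1} \<rightarrow>\<^sub>E {1, -1}) (fock_block \<nu>) (Fock \<nu>)"
proof (rule direct_sum_if_projections)
  show "block_proj \<nu> \<gamma> (u + v) = block_proj \<nu> \<gamma> u + block_proj \<nu> \<gamma> v" for \<gamma> u v
    by (simp add: block_proj_def w_proj_add sum.distrib)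
qed (use assms fock_block_Fock block_proj_in sum_block_proj block_proj_block in
      \<open>auto intro!: finite_PiE\<close>)

lemma inj_on_fock_block:
  assumes "1 \<le> \<nu>"
  shows "inj_on (fock_block \<nu>) ({1..\<nu> div 2 + 1} \<rightarrow>\<^sub>E {1, -1})"
proof (rule inj_onI)
  fix \<gamma> \<gamma>' assume "\<gamma> \<in> {1..\<nu> div 2 + 1} \<rightarrow>\<^sub>E {1, -1}" and eq: "fock_block \<nu> \<gamma> = fock_block \<nu> \<gamma>'"
  then obtain v where v: "v \<in> fock_block \<nu> \<gamma>" "v \<noteq> 0" using block_nonzero by blast
  then show "\<gamma> = \<gamma>'"
    using block_proj_block[OF assms, of v \<gamma> \<gamma>] block_proj_block[OF assms, of v \<gamma>' \<gamma>] eq by metis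
qed

lemma direct_sum_block_set:
  assumes "1 \<le> \<nu>"
  shows "direct_sum (fock_block \<nu> ` ({1..\<nu> div 2 + 1} \<rightarrow>\<^sub>E {1, -1})) (\<lambda>W. W) (Fock \<nu>)"
proof -
  define I :: "(nat \<Rightarrow> int) set" where "I = {1..\<nu> div 2 + 1} \<rightarrow>\<^sub>E {1, -1}"
  let ?label = "inv_into I (fock_block \<nu>)"
  have inj: "inj_on (fock_block \<nu>) I" using inj_on_fock_block[OF assms] by (simp add: I_def)
  have "direct_sum (fock_block \<nu> ` I) (\<lambda>W. W) (Fock \<nu>)"
  proof (rule direct_sum_if_projections)
    show "finite (fock_block \<nu> ` I)" by (auto simp: I_def intro!: finite_PiE)
    show "W \<subseteq> Fock \<nu>" if "W \<in> fock_block \<nu> ` I" for W using that fock_block_Fock by blast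
    show "block_proj \<nu> (?label W) v \<in> W" if "W \<in> fock_block \<nu> ` I" "v \<in> Fock \<nu>" for W v
      using block_proj_in[OF that(2), of "?label W"] f_inv_into_f[OF that(1)] by simp
    show "(\<Sum>W\<in>fock_block \<nu> ` I. block_proj \<nu> (?label W) v) = v" if "v \<in> Fock \<nu>" for v
      using sum_block_proj[OF assms that, folded I_def]
      by (simp add: sum.reindex[OF inj] inv_into_f_f[OF inj])
    show "block_proj \<nu> (?label W) (u + v) = block_proj \<nu> (?label W) u + block_proj \<nu> (?label W) v" for W u v
      by (simp add: block_proj_def w_proj_add sum.distrib)
    show "block_proj \<nu> (?label W) w = (if W = W' then w else 0)"
      if W: "W \<in> fock_block \<nu> ` I" "W' \<in> fock_block \<nu> ` I" "w \<in> W'" for W W' w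
    proof -
      obtain \<gamma> \<gamma>' where g: "\<gamma> \<in> I" "W = fock_block \<nu> \<gamma>" "\<gamma>' \<in> I" "W' = fock_block \<nu> \<gamma>'"
        using W(1,2) by (auto simp only: image_iff)
      then have "W = W' \<longleftrightarrow> \<gamma> = \<gamma>'" using inj by (auto dest: inj_onD)
      then show ?thesis
        using block_proj_block[OF assms, of w \<gamma>' \<gamma>] W(3) g inv_into_f_f[OF inj] by simp
    qed
  qed
  then show ?thesis by (simp add: I_def)
qed

section \<open>Vertex operators on subspaces and on the vacuum\<close>

lemma heis_eps: "heis (eps i) n v = heis1 i n v"
  by (simp add: heis_def eps_def del: single_one)

lemma heis_uminus_eps: "heis (- eps i) n v = pm_scale (-1) (heis1 i n v)"
  by (simp add: heis_def eps_def)

text \<open>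
  Stability under the Heisenberg operators alone already forces stability under all coefficients
  of products of the exponentials \<open>E\<close> (\<open>EE_coeff_stable\<close>). Applied to \<open>T = {0}\<close> this also says that
  these operators vanish at 0.
\<close>

definition heis_stable :: "nat \<Rightarrow> fock set \<Rightarrow> bool" where
  "heis_stable \<nu> T \<longleftrightarrow> module.subspace pm_scale T \<and>
     (\<forall>i\<in>{1..\<nu>}. \<forall>n. odd n \<longrightarrow> (\<forall>v\<in>T. heis1 i n v \<in> T))"

definition ser_stable :: "op_series \<Rightarrow> fock set \<Rightarrow> bool" where
  "ser_stable A T \<longleftrightarrow> (\<forall>N. \<forall>v\<in>T. A N v \<in> T)"

lemma ser_stable_mul:
  assumes "module.subspace pm_scale T" "ser_stable A T" "ser_stable B T"
  shows "ser_stable (ser_mul A B) T"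
  using assms unfolding ser_stable_def ser_mul_def by (auto intro!: pm.subspace_sum)

lemma ser_stable_exp:
  assumes T: "module.subspace pm_scale T" and A: "ser_stable A T"
  shows "ser_stable (ser_exp A) T"
proof -
  have "ser_stable (ser_pow A k) T" for k
  proof (induction k)
    case 0
    show ?case using pm.subspace_0[OF T] by (simp add: ser_stable_def)
  next
    case (Suc k)
    then show ?case using ser_stable_mul[OF T A] by simp
  qed
  then show ?thesis
    using T unfolding ser_stable_def ser_exp_def
    by (auto intro!: pm.subspace_sum pm.subspace_scale)
qed

lemma ser_stable_E_coeff:
  assumes "heis_stable \<nu> T" "i \<in> {1..\<nu>}" "\<alpha> = eps i \<or> \<alpha> = - eps i" "s = 1 \<or> s = -1"
  shows "ser_stable (E_coeff s \<alpha> a) T"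
proof -
  have T: "module.subspace pm_scale T" using assms(1) by (simp add: heis_stable_def)
  have "heis \<alpha> (s * int p) v \<in> T" if "odd p" "v \<in> T" for p v
  proof -
    have "odd (s * int p)" using assms(4) that by auto
    then have "heis1 i (s * int p) v \<in> T" using assms(1,2) that by (simp add: heis_stable_def)
    then show ?thesis using assms(3) by (auto simp: heis_eps heis_uminus_eps intro: pm.subspace_scale[OF T] pm.subspace_neg[OF T])
  qed
  then have "ser_stable (E_exponent s \<alpha> a) T"
    unfolding ser_stable_def E_exponent_def
    using pm.subspace_scale[OF T] pm.subspace_0[OF T] by (auto simp only: split: if_split)
  then show ?thesis unfolding E_coeff_def by (rule ser_stable_exp[OF T])
qed

lemma EE_coeff_stable:
  assumes T: "heis_stable \<nu> T" and ij: "i \<in> {1..\<nu>}" "j \<in> {1..\<nu>}" and v: "v \<in> T"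
  shows "EE_coeff i j a n v \<in> T"
proof -
  have sub: "module.subspace pm_scale T" using T by (simp add: heis_stable_def)
  have "ser_stable (ser_mul (E_coeff s (eps i) 1) (E_coeff s (- eps j) a)) T" if "s = 1 \<or> s = -1" for s
    using that by (intro ser_stable_mul sub ser_stable_E_coeff[OF T ij(1)] ser_stable_E_coeff[OF T ij(2)]) auto
  then show ?thesis
    unfolding EE_coeff_def Sum_any.expand_set using v
    by (intro pm.subspace_sum sub) (auto simp: ser_stable_def pm.subspace_0[OF sub])
qed

lemma heis_stable_0: "heis_stable \<nu> {0}"
  by (simp add: heis_stable_def heis1_def)

definition vacuum :: "nat \<Rightarrow> fock \<Rightarrow> bool" where
  "vacuum \<nu> v \<longleftrightarrow> (\<forall>i\<in>{1..\<nu>}. \<forall>n. 0 < n \<longrightarrow> heis1 i n v = 0)"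

lemma ser_pow_annihilated:
  assumes "\<And>N. A N v = 0" "\<And>N. A N 0 = 0"
  shows "ser_pow A k N v = (if k = 0 \<and> N = 0 then v else 0)"
proof (induction k arbitrary: N)
  case (Suc k)
  have "A l (ser_pow A k (N - l) v) = 0" for l
    by (simp add: Suc.IH assms)
  then show ?case by (simp add: ser_mul_def)
qed simp

lemma ser_exp_annihilated:
  assumes "\<And>N. A N v = 0" "\<And>N. A N 0 = 0"
  shows "ser_exp A N v = (if N = 0 then v else 0)"
proof -
  have "ser_exp A N v = (\<Sum>k\<le>N. if k = 0 then (if N = 0 then v else 0) else 0)"
    unfolding ser_exp_def by (intro sum.cong refl) (auto simp: ser_pow_annihilated[OF assms])
  then show ?thesis by simp
qed

lemma E_coeff_zero:
  assumes "i \<in> {1..\<nu>}" "\<alpha> = eps i \<or> \<alpha> = - eps i" "s = 1 \<or> s = -1"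
  shows "E_coeff s \<alpha> a N 0 = 0"
  using ser_stable_E_coeff[OF heis_stable_0 assms] by (simp add: ser_stable_def)

lemma E_coeff_plus_vacuum:
  assumes "vacuum \<nu> v" "i \<in> {1..\<nu>}" "\<alpha> = eps i \<or> \<alpha> = - eps i"
  shows "E_coeff 1 \<alpha> a N v = (if N = 0 then v else 0)"
  unfolding E_coeff_def
proof (rule ser_exp_annihilated)
  have 0: "heis \<alpha> (int p) u = 0" if "odd p" "u = v \<or> u = 0" for p u
  proof -
    have "0 < int p" using that(1) by (auto intro: Nat.gr0I)
    then have "heis1 i (int p) v = 0" using assms(1,2) by (simp add: vacuum_def)
    moreover have "heis1 i (int p) 0 = 0" by (simp add: heis1_def)
    ultimately show ?thesis using that(2) assms(3) by (auto simp: heis_eps heis_uminus_eps)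
  qed
  show "E_exponent 1 \<alpha> a N v = 0" "E_exponent 1 \<alpha> a N 0 = 0" for N
    by (simp_all add: E_exponent_def 0)
qed

text \<open>
  On vectors killed by the annihilators the factors \<open>E\<^sub>+\<close> act as the identity, and the constant
  term of the product of the two \<open>E\<^sub>-\<close> is the identity as well.
\<close>

lemma EE_coeff_vacuum:
  assumes v: "vacuum \<nu> v" and ij: "i \<in> {1..\<nu>}" "j \<in> {1..\<nu>}"
  shows "EE_coeff i j a 0 v = v"
proof -
  have plus: "ser_mul (E_coeff 1 (eps i) 1) (E_coeff 1 (- eps j) a) q v = (if q = 0 then v else 0)" for q
  proof -
    have "E_coeff 1 (eps i) 1 k (E_coeff 1 (- eps j) a (q - k) v) = (if q = 0 then v else 0)"
      if "k = q" for k
      using that v ij by (simp add: E_coeff_plus_vacuum)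
    moreover have "E_coeff 1 (eps i) 1 k (E_coeff 1 (- eps j) a (q - k) v) = 0" if "k < q" for k
      using that v ij by (simp add: E_coeff_plus_vacuum E_coeff_zero)
    ultimately have "ser_mul (E_coeff 1 (eps i) 1) (E_coeff 1 (- eps j) a) q v
        = (\<Sum>k\<le>q. if k = q then (if q = 0 then v else 0) else 0)"
      unfolding ser_mul_def by (intro sum.cong refl) (auto simp: le_less)
    then show ?thesis by simp
  qed
  have minus: "ser_mul (E_coeff (-1) (eps i) 1) (E_coeff (-1) (- eps j) a) q (if q = 0 then v else 0)
      = (if q = 0 then v else 0)" for q
  proof -
    have "ser_stable (ser_mul (E_coeff (-1) (eps i) 1) (E_coeff (-1) (- eps j) a)) {0}"
      by (intro ser_stable_mul ser_stable_E_coeff[OF heis_stable_0 ij(1)] ser_stable_E_coeff[OF heis_stable_0 ij(2)]) auto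
    then show ?thesis by (auto simp: ser_stable_def) (simp add: ser_mul_def E_coeff_def ser_exp_def)
  qed
  have "EE_coeff i j a 0 v = Sum_any (\<lambda>q::nat. v when q = 0)"
    unfolding EE_coeff_def plus by (simp add: minus when_def)
  then show ?thesis by simp
qed

section \<open>Stability of the blocks\<close>

lemma heis1_w_vec:
  "heis1 i n (w_vec \<nu> \<rho> m) = (if n < 0 then w_vec \<nu> \<rho> (m + Poly_Mapping.single (i, n) 1)
     else pm_scale (of_int n / 2 * of_nat (lookup m (i, -n))) (w_vec \<nu> \<rho> (m - Poly_Mapping.single (i, -n) 1)))"
proof (cases "n < 0")
  case True
  then show ?thesis by (simp add: w_vec_alt heis1_def lin_ext_lin_ext)
next
  case False
  let ?c = "of_int n / 2 * of_nat (lookup m (i, -n)) :: complex"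
  have "heis1 i n (w_vec \<nu> \<rho> m) = lin_ext (\<lambda>x. pm_scale ?c (Poly_Mapping.single (x, m - Poly_Mapping.single (i, -n) 1) 1)) (w_prod \<nu> \<rho>)"
    using False by (simp add: w_vec_alt heis1_def lin_ext_lin_ext pm_scale_single)
  then show ?thesis using False by (simp add: lin_ext_fun_scale w_vec_alt)
qed

lemma neg_odd_monos_add:
  "m \<in> neg_odd_monos \<nu> \<Longrightarrow> i \<in> {1..\<nu>} \<Longrightarrow> n < 0 \<Longrightarrow> odd n \<Longrightarrow> m + Poly_Mapping.single (i, n) 1 \<in> neg_odd_monos \<nu>"
  by (auto simp: neg_odd_monos_def dest!: subsetD[OF keys_add])

lemma neg_odd_monos_diff:
  "m \<in> neg_odd_monos \<nu> \<Longrightarrow> m - m' \<in> neg_odd_monos \<nu>"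
proof -
  assume m: "m \<in> neg_odd_monos \<nu>"
  have "keys (m - m') \<subseteq> keys m" by (auto simp: in_keys_iff lookup_minus)
  then show ?thesis using m by (auto simp: neg_odd_monos_def)
qed

lemma heis_stable_fock_block: "heis_stable \<nu> (fock_block \<nu> \<gamma>)"
  unfolding heis_stable_def
proof (intro conjI subspace_fock_block ballI allI impI)
  fix i n v assume i: "i \<in> {1..\<nu>}" "odd (n::int)" and v: "v \<in> fock_block \<nu> \<gamma>"
  have "v \<in> {v. heis1 i n v \<in> fock_block \<nu> \<gamma>}"
    using v
  proof (rule fock_block_induct)
    show "module.subspace pm_scale {v. heis1 i n v \<in> fock_block \<nu> \<gamma>}"
      unfolding heis1_def by (rule subspace_vimage_lin_ext[OF subspace_fock_block])
    fix \<rho> m assume *: "\<rho> \<in> {1..\<nu>} \<rightarrow> {1, -1}" "sign_class \<nu> \<rho> = \<gamma>" "m \<in> neg_odd_monos \<nu>"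
    then show "w_vec \<nu> \<rho> m \<in> {v. heis1 i n v \<in> fock_block \<nu> \<gamma>}"
      using i w_vec_in_fock_block[OF *(1)] neg_odd_monos_add[OF *(3) i(1)] neg_odd_monos_diff[OF *(3)]
      by (auto simp: heis1_w_vec intro!: pm.subspace_scale subspace_fock_block)
  qed
  then show "heis1 i n v \<in> fock_block \<nu> \<gamma>" by simp
qed

lemma grp_op_scale: "grp_op x (pm_scale c u) = pm_scale c (grp_op x u)"
  by (simp add: grp_op_def lin_ext_scale)

lemma grp_op_sum: "grp_op x (sum f A) = (\<Sum>a\<in>A. grp_op x (f a))"
  by (simp add: grp_op_def lin_ext_sum)

lemma grp_op_pair_w_vec:
  assumes "i \<in> {1..\<nu>}" "j \<in> {1..\<nu>}" "\<rho> \<in> {1..\<nu>} \<rightarrow> {1, -1}"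
  shows "grp_op (cls (eps i)) (grp_op (cls (eps j)) (w_vec \<nu> \<rho> m))
    = pm_scale (w_const j * of_int (\<rho> j) * (w_const i * of_int (flip_signs j \<rho> i)))
        (w_vec \<nu> (flip_signs i (flip_signs j \<rho>)) m)"
  using assms by (simp only: grp_op_eps_w_vec flip_signs_signs grp_op_scale pm.scale_scale)

lemma grp_op_pair_stable:
  assumes ij: "i \<in> {1..\<nu>}" "j \<in> {1..\<nu>}" and v: "v \<in> fock_block \<nu> \<gamma>"
  shows "grp_op (cls (eps i)) (grp_op (cls (eps j)) v) \<in> fock_block \<nu> \<gamma>"
proof -
  have lin: "grp_op (cls (eps i)) (grp_op (cls (eps j)) v)
      = lin_ext (\<lambda>b. grp_op (cls (eps i)) (grp_op (cls (eps j)) (Poly_Mapping.single b 1))) v" for v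
    by (simp add: grp_op_def lin_ext_lin_ext)
  have "v \<in> {v. grp_op (cls (eps i)) (grp_op (cls (eps j)) v) \<in> fock_block \<nu> \<gamma>}"
    using v
  proof (rule fock_block_induct)
    show "module.subspace pm_scale {v. grp_op (cls (eps i)) (grp_op (cls (eps j)) v) \<in> fock_block \<nu> \<gamma>}"
      using subspace_vimage_lin_ext[OF subspace_fock_block,
          of "\<lambda>b. grp_op (cls (eps i)) (grp_op (cls (eps j)) (Poly_Mapping.single b 1))" \<nu> \<gamma>]
      by (simp only: lin[symmetric])
    fix \<rho> m assume *: "\<rho> \<in> {1..\<nu>} \<rightarrow> {1, -1}" "sign_class \<nu> \<rho> = \<gamma>" "m \<in> neg_odd_monos \<nu>"
    have "w_vec \<nu> (flip_signs i (flip_signs j \<rho>)) m \<in> fock_block \<nu> \<gamma>"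
      using w_vec_in_fock_block[of "flip_signs i (flip_signs j \<rho>)" \<nu> m]
      by (simp only: flip_signs_signs * sign_class_flip_flip[OF ij] simp_thms)
    then show "w_vec \<nu> \<rho> m \<in> {v. grp_op (cls (eps i)) (grp_op (cls (eps j)) v) \<in> fock_block \<nu> \<gamma>}"
      using grp_op_pair_w_vec[OF ij *(1)] by (simp add: pm.subspace_scale[OF subspace_fock_block])
  qed
  then show ?thesis by simp
qed

lemma x_op_stable:
  assumes ij: "i \<in> {1..\<nu>}" "j \<in> {1..\<nu>}" and v: "v \<in> fock_block \<nu> \<gamma>"
  shows "x_op i j a n v \<in> fock_block \<nu> \<gamma>"
proof -
  have EE: "EE_coeff i j a n v \<in> fock_block \<nu> \<gamma>"
    by (rule EE_coeff_stable[OF heis_stable_fock_block ij v])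
  have T: "module.subspace pm_scale (fock_block \<nu> \<gamma>)" by (rule subspace_fock_block)
  show ?thesis
  proof (cases "i = j")
    case True
    moreover have "odd n \<Longrightarrow> heis1 i n v \<in> fock_block \<nu> \<gamma>"
      using heis_stable_fock_block[of \<nu> \<gamma>] ij v by (auto simp: heis_stable_def)
    ultimately show ?thesis
      using EE v by (auto simp: x_op_def heis_eps intro!: pm.subspace_scale[OF T] pm.subspace_diff[OF T] pm.subspace_0[OF T])
  next
    case False
    then show ?thesis by (simp add: x_op_def grp_op_eps_diff grp_op_pair_stable[OF ij EE])
  qed
qed

section \<open>Generators of the unitary Lie algebra\<close>

lemma character_zero: "character \<sigma> \<Longrightarrow> \<sigma> 0 = 1"
  unfolding character_def by (metis add_0 mult_cancel_right1)

lemma rbar_rbar_basis: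
  assumes "character \<sigma>"
  shows "rbar \<sigma> (rbar \<sigma> (Poly_Mapping.single (m, \<alpha>) 1)) = Poly_Mapping.single (m, \<alpha>) 1"
proof -
  have "\<sigma> \<alpha> * \<sigma> (- \<alpha>) = 1"
    using assms character_zero[OF assms] unfolding character_def by (metis add.right_inverse)
  then have "\<sigma> (- \<alpha>) powi m * \<sigma> \<alpha> powi m = 1"
    by (metis power_int_mult_distrib mult.commute power_int_1_left)
  moreover have "(-1 :: complex) powi m * (-1) powi m = 1"
    by (simp add: powi_minus_one_parity)
  ultimately have "((-1) powi m * \<sigma> (- \<alpha>) powi m) * ((-1) powi m * \<sigma> \<alpha> powi m) = 1"
    by (metis mult.assoc mult.left_commute mult.right_neutral)
  then show ?thesis by (simp add: rbar_def pm_scale_single del: single_one)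
qed

lemma rbar_add: "rbar \<sigma> (r + s) = rbar \<sigma> r + rbar \<sigma> s"
  by (simp add: rbar_def lin_ext_add)

lemma rbar_0: "rbar \<sigma> 0 = 0"
  by (simp add: rbar_def)

lemma e_gen_apply:
  "e_gen \<sigma> i j m \<alpha> k l = (if k = i \<and> l = j then Poly_Mapping.single (m, \<alpha>) 1 else 0)
     - (if k = j \<and> l = i then rbar \<sigma> (Poly_Mapping.single (m, \<alpha>) 1) else 0)"
  by (simp add: e_gen_def mat_unit_def)

lemma uhat_iff:
  "x \<in> uhat \<nu> \<sigma> \<longleftrightarrow> (\<forall>i j. fst x i j \<noteq> 0 \<longrightarrow> i \<in> {1..\<nu>} \<and> j \<in> {1..\<nu>}) \<and>
     (\<forall>i j. rbar \<sigma> (fst x j i) = - fst x i j)"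
  by (simp add: uhat_def Mat_def mstar_def fun_eq_iff)

lemma e_gen_uhat:
  assumes "character \<sigma>" "i \<in> {1..\<nu>}" "j \<in> {1..\<nu>}"
  shows "(e_gen \<sigma> i j m \<alpha>, 0) \<in> uhat \<nu> \<sigma>"
  unfolding uhat_iff fst_conv
proof (intro conjI allI impI)
  fix k l
  let ?r = "Poly_Mapping.single (m, \<alpha>) 1"
  have "rbar \<sigma> (r - s) = rbar \<sigma> r - rbar \<sigma> s" for r s by (simp add: rbar_def lin_ext_diff)
  then have "rbar \<sigma> (e_gen \<sigma> i j m \<alpha> l k)
      = (if l = i \<and> k = j then rbar \<sigma> ?r else 0) - (if l = j \<and> k = i then rbar \<sigma> (rbar \<sigma> ?r) else 0)"
    unfolding e_gen_apply by (simp only: if_distrib[of "rbar \<sigma>"] rbar_0)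
  then show "rbar \<sigma> (e_gen \<sigma> i j m \<alpha> l k) = - e_gen \<sigma> i j m \<alpha> k l"
    unfolding e_gen_apply rbar_rbar_basis[OF assms(1)] by (simp only: minus_diff_eq conj_commute)
  assume nz: "e_gen \<sigma> i j m \<alpha> k l \<noteq> 0"
  have "k = i \<and> l = j \<or> k = j \<and> l = i"
  proof (rule ccontr)
    assume "\<not> (k = i \<and> l = j \<or> k = j \<and> l = i)"
    then have "(k = i \<and> l = j) = False" "(k = j \<and> l = i) = False" by blast+
    with nz show False by (simp only: e_gen_apply if_False diff_0_right simp_thms)
  qed
  then show "k \<in> {1..\<nu>}" "l \<in> {1..\<nu>}" using assms(2,3) by blast+
qed

lemma uhat_add:
  assumes "x \<in> uhat \<nu> \<sigma>" "y \<in> uhat \<nu> \<sigma>"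
  shows "x + y \<in> uhat \<nu> \<sigma>"
  unfolding uhat_iff fst_add plus_fun_apply
proof (intro conjI allI impI)
  fix i j
  show "rbar \<sigma> (fst x j i + fst y j i) = - (fst x i j + fst y i j)"
    using assms unfolding uhat_iff by (simp only: rbar_add minus_add_distrib)
  assume "fst x i j + fst y i j \<noteq> 0"
  then have "fst x i j \<noteq> 0 \<or> fst y i j \<noteq> 0" by auto
  then show "i \<in> {1..\<nu>}" "j \<in> {1..\<nu>}" using assms unfolding uhat_iff by blast+
qed

lemma uhat_scale:
  assumes "x \<in> uhat \<nu> \<sigma>"
  shows "ghat_scale c x \<in> uhat \<nu> \<sigma>"
proof -
  have "rbar \<sigma> (pm_scale c r) = pm_scale c (rbar \<sigma> r)" for r
    by (simp add: rbar_def lin_ext_scale)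
  then show ?thesis
    using assms unfolding uhat_iff ghat_scale_def fst_conv
    by (simp only: pm.scale_eq_0_iff pm.scale_minus_right) blast
qed

lemma central_uhat: "(0, 1) \<in> uhat \<nu> \<sigma>"
  by (simp add: uhat_def Mat_def mstar_def rbar_0 fun_eq_iff)

lemma sum_apply2: "(\<Sum>a\<in>A. f a) k l = (\<Sum>a\<in>A. f a k l)"
  by (induction A rule: infinite_finite_induct) simp_all

lemma sum_pm_scale_if_diff:
  "(\<Sum>b\<in>K. pm_scale (f b) ((if A then g b else 0) - (if B then h b else 0)))
    = (if A then \<Sum>b\<in>K. pm_scale (f b) (g b) else 0) - (if B then \<Sum>b\<in>K. pm_scale (f b) (h b) else 0)"
  by (cases A; cases B) (simp_all add: pm.scale_right_diff_distrib sum_subtractf sum_negf)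

text \<open>
  As \<open>X\<^sup>* = -X\<close>, one has \<open>X = (X - X\<^sup>*) / 2\<close>; expanding the entries of \<open>X\<close> into monomials turns
  the right-hand side into a combination of the elements \<open>e_ij(m, \<alpha>)\<close>.
\<close>

lemma uhat_decomposition:
  assumes "(X, a) \<in> uhat \<nu> \<sigma>"
  shows "(X, a) = (\<Sum>i\<in>{1..\<nu>}. \<Sum>j\<in>{1..\<nu>}. \<Sum>(m, \<alpha>)\<in>keys (X i j).
      ghat_scale (lookup (X i j) (m, \<alpha>) / 4) (ghat_scale 2 (e_gen \<sigma> i j m \<alpha>, 0)))
    + ghat_scale a (0, 1)" (is "_ = ?s + _")
proof (rule prod_eqI)
  have X: "X \<in> Mat \<nu>" "mstar \<sigma> X = - X" using assms by (simp_all add: uhat_def)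
  show "snd (X, a) = snd (?s + ghat_scale a (0, 1))"
    by (simp add: snd_sum ghat_scale_def case_prod_unfold)
  \<comment> \<open>the factor 1/4 is the 1/2 of \<open>(X - X\<^sup>*) / 2\<close> divided by the 2 of the
     generators\<close>
  have entry: "(\<Sum>(m, \<alpha>)\<in>keys r. pm_scale (lookup r (m, \<alpha>) / 4) (pm_scale 2 (e_gen \<sigma> i j m \<alpha> k l)))
      = (if k = i \<and> l = j then pm_scale (1/2) r else 0)
      - (if k = j \<and> l = i then pm_scale (1/2) (rbar \<sigma> r) else 0)" for r i j k l
  proof -
    have 1: "pm_scale (1/2) r = (\<Sum>b\<in>keys r. pm_scale (lookup r b / 2) (Poly_Mapping.single b 1))"
      by (subst lin_ext_of_singles[of r, symmetric])
         (simp add: lin_ext_def pm.scale_sum_right)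
    have "rbar \<sigma> r = (\<Sum>b\<in>keys r. pm_scale (lookup r b) (rbar \<sigma> (Poly_Mapping.single b 1)))"
      by (subst sum_of_singles[of r]) (simp add: rbar_def lin_ext_sum)
    then have 2: "pm_scale (1/2) (rbar \<sigma> r)
        = (\<Sum>b\<in>keys r. pm_scale (lookup r b / 2) (rbar \<sigma> (Poly_Mapping.single b 1)))"
      by (simp add: pm.scale_sum_right)
    have "(\<Sum>(m, \<alpha>)\<in>keys r. pm_scale (lookup r (m, \<alpha>) / 4) (pm_scale 2 (e_gen \<sigma> i j m \<alpha> k l)))
      = (\<Sum>b\<in>keys r. pm_scale (lookup r b / 2)
          ((if k = i \<and> l = j then Poly_Mapping.single b 1 else 0)
          - (if k = j \<and> l = i then rbar \<sigma> (Poly_Mapping.single b 1) else 0)))"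
      by (intro sum.cong refl) (auto simp: e_gen_apply)
    also have "\<dots> = (if k = i \<and> l = j then \<Sum>b\<in>keys r. pm_scale (lookup r b / 2) (Poly_Mapping.single b 1) else 0)
      - (if k = j \<and> l = i then \<Sum>b\<in>keys r. pm_scale (lookup r b / 2) (rbar \<sigma> (Poly_Mapping.single b 1)) else 0)"
      by (rule sum_pm_scale_if_diff)
    finally show ?thesis by (simp only: 1 2)
  qed
  have "fst (?s + ghat_scale a (0, 1)) k l = X k l" for k l
  proof -
    have "fst (?s + ghat_scale a (0, 1)) k l
      = (\<Sum>i\<in>{1..\<nu>}. \<Sum>j\<in>{1..\<nu>}. \<Sum>(m, \<alpha>)\<in>keys (X i j).
          pm_scale (lookup (X i j) (m, \<alpha>) / 4) (pm_scale 2 (e_gen \<sigma> i j m \<alpha> k l)))"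
      by (simp only: fst_add fst_sum case_prod_unfold ghat_scale_def fst_conv plus_fun_apply sum_apply2
          zero_fun_apply pm.scale_zero_right add_0_right)
    also have "\<dots> = (\<Sum>i\<in>{1..\<nu>}. \<Sum>j\<in>{1..\<nu>}. (if k = i \<and> l = j then pm_scale (1/2) (X i j) else 0)
      - (if k = j \<and> l = i then pm_scale (1/2) (rbar \<sigma> (X i j)) else 0))"
      by (simp only: entry)
    also have "\<dots> = (\<Sum>i\<in>{1..\<nu>}. \<Sum>j\<in>{1..\<nu>}. if j = l then (if i = k then pm_scale (1/2) (X k l) else 0) else 0)
      - (\<Sum>i\<in>{1..\<nu>}. \<Sum>j\<in>{1..\<nu>}. if j = k then (if i = l then pm_scale (1/2) (rbar \<sigma> (X l k)) else 0) else 0)"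
      unfolding sum_subtractf by (intro arg_cong2[where f = "(-)"] sum.cong refl) auto
    also have "\<dots> = (if k \<in> {1..\<nu>} \<and> l \<in> {1..\<nu>} then pm_scale (1/2) (X k l - rbar \<sigma> (X l k)) else 0)"
      by (cases "k \<in> {1..\<nu>}"; cases "l \<in> {1..\<nu>}")
         (simp_all add: pm.scale_right_diff_distrib del: atLeastAtMost_iff)
    also have "\<dots> = X k l"
    proof -
      have "rbar \<sigma> (X l k) = - X k l" using X(2) by (metis mstar_def fun_Compl_def)
      moreover have "pm_scale (1/2) (r + r) = r" for r :: "'a rsig"
        by (rule poly_mapping_eqI, simp only: lookup_pm_scale lookup_add) simp
      moreover have "X k l = 0" if "\<not> (k \<in> {1..\<nu>} \<and> l \<in> {1..\<nu>})" using X(1) that unfolding Mat_def by blast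
      ultimately show ?thesis 
        by (cases "k \<in> {1..\<nu>} \<and> l \<in> {1..\<nu>}") (simp_all only: if_True if_False diff_minus_eq_add simp_thms)
    qed
    finally show ?thesis .
  qed
  then show "fst (X, a) = fst (?s + ghat_scale a (0, 1))" by (simp add: fun_eq_iff)
qed

lemma uhat_induct:
  assumes x: "x \<in> uhat \<nu> \<sigma>" and \<sigma>: "character \<sigma>"
    and add: "\<And>x y. x \<in> uhat \<nu> \<sigma> \<Longrightarrow> y \<in> uhat \<nu> \<sigma> \<Longrightarrow> P x \<Longrightarrow> P y \<Longrightarrow> P (x + y)"
    and scale: "\<And>c x. x \<in> uhat \<nu> \<sigma> \<Longrightarrow> P x \<Longrightarrow> P (ghat_scale c x)"
    and gen: "\<And>i j m \<alpha>. i \<in> {1..\<nu>} \<Longrightarrow> j \<in> {1..\<nu>} \<Longrightarrow> P (ghat_scale 2 (e_gen \<sigma> i j m \<alpha>, 0))"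
    and central: "P (0, 1)"
  shows "P x"
proof -
  define Q where "Q y \<longleftrightarrow> y \<in> uhat \<nu> \<sigma> \<and> P y" for y
  have Q_add: "Q (y + z)" if "Q y" "Q z" for y z using that by (auto simp: Q_def uhat_add add)
  have Q_scale: "Q (ghat_scale c y)" if "Q y" for c y using that by (auto simp: Q_def uhat_scale scale)
  have Q_c: "Q (0, 1)" by (simp add: Q_def central_uhat central)
  have "ghat_scale 0 (0, 1) = (0 :: 'a rmat \<times> complex)"
    by (simp add: ghat_scale_def prod_eq_iff fun_eq_iff)
  then have Q_0: "Q 0" using Q_scale[OF Q_c, of 0] by simp
  have Q_sum: "Q (sum f A)" if "\<And>a. a \<in> A \<Longrightarrow> Q (f a)" for f :: "int \<times> 'a \<Rightarrow> 'a rmat \<times> complex" and A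
    using that by (induction A rule: infinite_finite_induct) (auto simp: Q_0 Q_add)
  have Q_sum': "Q (sum f A)" if "\<And>a. a \<in> A \<Longrightarrow> Q (f a)" for f :: "nat \<Rightarrow> 'a rmat \<times> complex" and A
    using that by (induction A rule: infinite_finite_induct) (auto simp: Q_0 Q_add)
  have Q_gen: "Q (ghat_scale 2 (e_gen \<sigma> i j m \<alpha>, 0))" if "i \<in> {1..\<nu>}" "j \<in> {1..\<nu>}" for i j m \<alpha>
    using that gen by (simp add: Q_def uhat_scale e_gen_uhat[OF \<sigma>])
  obtain X a where X: "x = (X, a)" by (cases x)
  have "Q (X, a)"
    by (subst uhat_decomposition[OF x[unfolded X]])
       (auto intro!: Q_add Q_sum Q_sum' Q_scale[OF Q_c] Q_scale[OF Q_gen] simp del: atLeastAtMost_iff)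
  then show ?thesis by (simp add: X Q_def)
qed

lemma lie_module_stable:
  assumes \<sigma>: "character \<sigma>"
    and mod: "lie_module (uhat \<nu> \<sigma>) ghat_scale (ghat_bracket \<nu> \<sigma>) V pm_scale act"
    and T: "module.subspace pm_scale T" "T \<subseteq> V"
    and gen: "\<And>i j m \<alpha> v. i \<in> {1..\<nu>} \<Longrightarrow> j \<in> {1..\<nu>} \<Longrightarrow> v \<in> T \<Longrightarrow>
      act (ghat_scale 2 (e_gen \<sigma> i j m \<alpha>, 0)) v \<in> T"
    and central: "\<And>v. v \<in> T \<Longrightarrow> act (0, 1) v \<in> T"
  shows "submodule (uhat \<nu> \<sigma>) V pm_scale act T"
proof -
  have act_add: "act (x + y) v = act x v + act y v"
    if "x \<in> uhat \<nu> \<sigma>" "y \<in> uhat \<nu> \<sigma>" "v \<in> V" for x y v using mod that by (auto simp: lie_module_def)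
  have act_scale: "act (ghat_scale c x) v = pm_scale c (act x v)"
    if "x \<in> uhat \<nu> \<sigma>" "v \<in> V" for c x v using mod that by (auto simp: lie_module_def)
  have "\<forall>v\<in>T. act x v \<in> T" if "x \<in> uhat \<nu> \<sigma>" for x
    using that \<sigma>
  proof (rule uhat_induct)
    show "\<forall>v\<in>T. act (x + y) v \<in> T"
      if "x \<in> uhat \<nu> \<sigma>" "y \<in> uhat \<nu> \<sigma>" "\<forall>v\<in>T. act x v \<in> T" "\<forall>v\<in>T. act y v \<in> T" for x y
    proof
      fix v assume "v \<in> T"
      then have "act (x + y) v = act x v + act y v" using that(1,2) T(2) by (intro act_add) auto
      then show "act (x + y) v \<in> T" using that(3,4) \<open>v \<in> T\<close> by (simp add: pm.subspace_add[OF T(1)])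
    qed
    show "\<forall>v\<in>T. act (ghat_scale c x) v \<in> T" if "x \<in> uhat \<nu> \<sigma>" "\<forall>v\<in>T. act x v \<in> T" for c x
    proof
      fix v assume "v \<in> T"
      then have "act (ghat_scale c x) v = pm_scale c (act x v)" using that(1) T(2) by (intro act_scale) auto
      then show "act (ghat_scale c x) v \<in> T" using that(2) \<open>v \<in> T\<close> by (simp add: pm.subspace_scale[OF T(1)])
    qed
  qed (use gen central in auto)
  then show ?thesis using T by (simp add: submodule_def)
qed

section \<open>Minimality of the blocks\<close>

definition mono_degree :: "mono \<Rightarrow> nat" where
  "mono_degree m = (\<Sum>k\<in>keys m. lookup m k)"

lemma mono_degree_add_single: "mono_degree (m + Poly_Mapping.single k 1) = Suc (mono_degree m)"
proof -
  let ?K = "insert k (keys m)"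
  have "mono_degree (m + Poly_Mapping.single k 1) = (\<Sum>l\<in>?K. lookup (m + Poly_Mapping.single k 1) l)"
    unfolding mono_degree_def by (intro sum.mono_neutral_left) (auto simp: in_keys_iff lookup_add lookup_single when_def split: if_splits)
  also have "\<dots> = (\<Sum>l\<in>?K. lookup m l) + (\<Sum>l\<in>?K. if l = k then 1 else 0)"
    unfolding sum.distrib[symmetric] by (intro sum.cong refl) (auto simp: lookup_add lookup_single when_def)
  also have "(\<Sum>l\<in>?K. lookup m l) = mono_degree m"
    unfolding mono_degree_def by (intro sum.mono_neutral_right) (auto simp: in_keys_iff)
  finally show ?thesis by simp
qed

lemma mono_nonzero_key:
  assumes "m \<noteq> (0 :: mono)"
  obtains i n where "(i, n) \<in> keys m"
proof -
  obtain k where "lookup m k \<noteq> lookup 0 k" using assms by (meson poly_mapping_eqI)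
  then show ?thesis using that[of "fst k" "snd k"] by (simp add: in_keys_iff)
qed

lemma mono_degree_eq_0_iff: "mono_degree m = 0 \<longleftrightarrow> m = 0"
proof
  assume "mono_degree m = 0"
  then show "m = 0" by (auto simp: mono_degree_def in_keys_iff elim!: mono_nonzero_key intro: ccontr)
qed (simp add: mono_degree_def)

lemma mono_diff_add_single:
  assumes "k \<in> keys (m :: mono)"
  shows "m - Poly_Mapping.single k 1 + Poly_Mapping.single k 1 = m"
  using assms by (intro poly_mapping_eqI) (auto simp: in_keys_iff lookup_add lookup_minus lookup_single when_def)

lemma lookup_heis1_pos:
  assumes "0 < n"
  shows "lookup (heis1 i n v) (x, m)
    = of_int n / 2 * of_nat (Suc (lookup m (i, -n))) * lookup v (x, m + Poly_Mapping.single (i, -n) 1)"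
proof -
  let ?s = "Poly_Mapping.single (i, -n) 1 :: mono"
  let ?c = "of_int n / 2 * of_nat (Suc (lookup m (i, -n))) :: complex"
  have "lookup (heis1 i n v) (x, m) = (\<Sum>b\<in>keys v. if b = (x, m + ?s) then ?c * lookup v (x, m + ?s) else 0)"
    unfolding heis1_def lookup_lin_ext
  proof (intro sum.cong refl)
    fix b assume "b \<in> keys v"
    obtain y l where b: "b = (y, l)" by (cases b)
    have "(y, l - ?s) = (x, m) \<and> lookup l (i, -n) \<noteq> 0 \<longleftrightarrow> b = (x, m + ?s)"
      using mono_diff_add_single[of "(i, -n)" l] by (auto simp: b in_keys_iff lookup_add)
    then show "lookup v b * lookup (case b of (x, m) \<Rightarrow>
        if n < 0 then Poly_Mapping.single (x, m + Poly_Mapping.single (i, n) 1) 1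
        else Poly_Mapping.single (x, m - Poly_Mapping.single (i, - n) 1) (of_int n / 2 * of_nat (lookup m (i, - n)))) (x, m)
      = (if b = (x, m + ?s) then ?c * lookup v (x, m + ?s) else 0)"
      using assms by (auto simp: b lookup_single when_def lookup_add)
  qed
  then show ?thesis by (auto simp: in_keys_iff)
qed

text \<open>
  The subspace \<open>\<complex>[\<Gamma>/2\<Gamma>] \<otimes> 1\<close>.
\<close>

definition group_part :: "fock set" where
  "group_part = {v. keys v \<subseteq> UNIV \<times> {0}}"

lemma vacuum_if_group_part: "v \<in> group_part \<Longrightarrow> vacuum \<nu> v"
  unfolding vacuum_def
proof (intro ballI allI impI, rule poly_mapping_eqI, clarify)
  fix i n x m assume v: "v \<in> group_part" and "0 < (n::int)"
  have "lookup (m + Poly_Mapping.single (i, -n) 1) (i, -n) \<noteq> lookup (0 :: mono) (i, -n)"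
    by (simp add: lookup_add)
  then have "(x, m + Poly_Mapping.single (i, -n) 1) \<notin> keys v" using v by (auto simp: group_part_def)
  then show "lookup (heis1 i n v) (x, m) = lookup 0 (x, m)"
    using \<open>0 < n\<close> by (simp add: lookup_heis1_pos in_keys_iff)
qed

text \<open>
  A vector that involves the variable \<open>\<epsilon>\<^sub>i(n)\<close> has a nonzero derivative with respect to it, of
  smaller degree. Differentiating until no variable is left ends in the group algebra.
\<close>

lemma exists_vacuum_vector:
  assumes N: "heis_stable \<nu> N" "N \<subseteq> Fock \<nu>" and v: "v \<in> N" "v \<noteq> 0"
  shows "\<exists>w\<in>N. w \<noteq> 0 \<and> w \<in> group_part"
proof -
  have "\<exists>w\<in>N. w \<noteq> 0 \<and> w \<in> group_part"
    if "v \<in> N" "v \<noteq> 0" "\<forall>(x, m)\<in>keys v. mono_degree m \<le> D" for D v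
    using that
  proof (induction D arbitrary: v)
    case 0
    have "m = 0" if "(x, m) \<in> keys v" for x m
    proof -
      have "mono_degree m \<le> 0" using bspec[OF 0(3) that] by simp
      then show ?thesis by (simp add: mono_degree_eq_0_iff)
    qed
    then have "v \<in> group_part" by (auto simp: group_part_def)
    then show ?case using 0 by blast
  next
    case (Suc D)
    show ?case
    proof (cases "v \<in> group_part")
      case True
      then show ?thesis using Suc.prems by blast
    next
      case False
      then obtain x m where xm: "(x, m) \<in> keys v" "m \<noteq> 0" by (auto simp: group_part_def)
      from xm(2) obtain i n where k: "(i, n) \<in> keys m" by (rule mono_nonzero_key)
      have "(x, m) \<in> lat2_below \<nu> \<times> neg_odd_monos \<nu>" using xm(1) Suc.prems(1) N(2) by (auto simp: Fock_alt)
      then have i: "i \<in> {1..\<nu>}" "n < 0" "odd n" using k by (auto simp: neg_odd_monos_def)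
      let ?w = "heis1 i (- n) v"
      have "?w \<in> N" using N(1) i Suc.prems(1) by (simp add: heis_stable_def)
      moreover have "?w \<noteq> 0"
      proof
        assume "?w = 0"
        then have "lookup ?w (x, m - Poly_Mapping.single (i, n) 1) = 0" by simp
        moreover have "lookup v (x, m) \<noteq> 0" using xm(1) by (simp add: in_keys_iff)
        ultimately show False
          using i mono_diff_add_single[OF k] by (simp add: lookup_heis1_pos del: of_nat_Suc)
      qed
      moreover have "\<forall>(y, l)\<in>keys ?w. mono_degree l \<le> D"
      proof (clarify)
        fix y l assume "(y, l) \<in> keys ?w"
        then have "(y, l + Poly_Mapping.single (i, n) 1) \<in> keys v"
          using i by (auto simp: in_keys_iff lookup_heis1_pos)
        then have "mono_degree (l + Poly_Mapping.single (i, n) 1) \<le> Suc D" using Suc.prems(3) by blast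
        then show "mono_degree l \<le> D" by (simp only: mono_degree_add_single Suc_le_mono)
      qed
      ultimately show ?thesis by (rule Suc.IH)
    qed
  qed
  moreover have "\<forall>(x, m)\<in>keys v. mono_degree m \<le> Max ((\<lambda>b. mono_degree (snd b)) ` keys v)"
  proof clarify
    fix x m assume "(x, m) \<in> keys v"
    then show "mono_degree m \<le> Max ((\<lambda>b. mono_degree (snd b)) ` keys v)"
      by (intro Max_ge) (auto simp: image_iff intro!: bexI[of _ "(x, m)"])
  qed
  ultimately show ?thesis using v by blast
qed

lemma group_part_expansion:
  assumes "1 \<le> \<nu>" "w \<in> fock_block \<nu> \<gamma>" "w \<in> group_part"
  shows "\<exists>a. w = (\<Sum>\<rho> | \<rho> \<in> sign_vectors \<nu> \<and> sign_class \<nu> \<rho> = \<gamma>. pm_scale (a \<rho>) (w_vec \<nu> \<rho> 0))"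
proof -
  let ?a = "\<lambda>\<rho>. \<Sum>b\<in>keys w. lookup w b * (cnj (w_char \<nu> \<rho> (fst b)) / 2 ^ \<nu>)"
  have "w_proj \<nu> \<rho> w = pm_scale (?a \<rho>) (w_vec \<nu> \<rho> 0)" for \<rho>
    unfolding w_proj_def lin_ext_def pm.scale_sum_left
  proof (intro sum.cong refl)
    fix b assume "b \<in> keys w"
    then obtain x where "b = (x, 0)" using assms(3) by (auto simp: group_part_def)
    then show "pm_scale (lookup w b) (case b of (x, m) \<Rightarrow> pm_scale (cnj (w_char \<nu> \<rho> x) / 2 ^ \<nu>) (w_vec \<nu> \<rho> m))
      = pm_scale (lookup w b * (cnj (w_char \<nu> \<rho> (fst b)) / 2 ^ \<nu>)) (w_vec \<nu> \<rho> 0)"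
      by simp
  qed
  then have "block_proj \<nu> \<gamma> w
      = (\<Sum>\<rho> | \<rho> \<in> sign_vectors \<nu> \<and> sign_class \<nu> \<rho> = \<gamma>. pm_scale (?a \<rho>) (w_vec \<nu> \<rho> 0))"
    by (simp only: block_proj_def)
  then show ?thesis
    using block_proj_block[OF assms(1,2), of \<gamma>] by (intro exI[of _ ?a]) (simp only: if_True simp_thms)
qed

lemma sign_class_eqD:
  assumes "sign_class \<nu> \<rho> = sign_class \<nu> \<rho>'" "1 \<le> \<nu>"
  shows "\<rho> 1 = \<rho>' 1"
    and "1 \<le> k \<Longrightarrow> 2 * k \<le> \<nu> \<Longrightarrow> \<rho> (2 * k) * (if 2 * k + 1 \<le> \<nu> then \<rho> (2 * k + 1) else 1)
      = \<rho>' (2 * k) * (if 2 * k + 1 \<le> \<nu> then \<rho>' (2 * k + 1) else 1)"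
proof -
  show "\<rho> 1 = \<rho>' 1" using fun_cong[OF assms(1), of 1] by (simp add: sign_class_def)
  assume "1 \<le> k" "2 * k \<le> \<nu>"
  then have "k + 1 \<in> {1..\<nu> div 2 + 1}" "k + 1 \<noteq> 1" "2 * (k + 1) - 1 = 2 * k + 1" by auto
  then show "\<rho> (2 * k) * (if 2 * k + 1 \<le> \<nu> then \<rho> (2 * k + 1) else 1)
      = \<rho>' (2 * k) * (if 2 * k + 1 \<le> \<nu> then \<rho>' (2 * k + 1) else 1)"
    using fun_cong[OF assms(1), of "k + 1"] unfolding sign_class_def by (simp only: restrict_apply if_True if_False add_diff_cancel_right')
qed

lemma sign_mult_cancel:
  fixes a b c d :: int
  assumes "a \<in> {1, -1}" "b \<in> {1, -1}" "c \<in> {1, -1}" "d \<in> {1, -1}" "a * b = c * d"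
  shows "a = c \<longleftrightarrow> b = d"
  using assms by auto

lemma nat_pair_cases:
  fixes j :: nat
  assumes "1 \<le> j"
  obtains "j = 1" | k where "1 \<le> k" "j = 2 * k" | k where "1 \<le> k" "j = 2 * k + 1"
proof (cases "even j")
  case True
  then obtain k where "j = 2 * k" by (elim evenE)
  then show ?thesis using assms that(2)[of k] by simp
next
  case False
  then obtain k where "j = 2 * k + 1" by (elim oddE)
  then show ?thesis using that(1) that(3)[of k] by (cases k) auto
qed

text \<open>
  The class fixes \<open>\<rho>\<^sub>1\<close> and the products \<open>\<rho>\<^sub>2\<^sub>k \<rho>\<^sub>2\<^sub>k\<^sub>+\<^sub>1\<close>, the eigenvalues fix \<open>\<rho>\<^sub>2\<^sub>k\<^sub>-\<^sub>1 \<rho>\<^sub>2\<^sub>k\<close>; together they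
  give the entries one after the other.
\<close>

lemma sign_vector_determined:
  assumes \<rho>: "\<rho> \<in> {1..\<nu>} \<rightarrow> {1, -1}" "\<rho>' \<in> {1..\<nu>} \<rightarrow> {1, -1}"
    and cl: "sign_class \<nu> \<rho> = sign_class \<nu> \<rho>'"
    and pairs: "\<And>k. 1 \<le> k \<Longrightarrow> 2 * k \<le> \<nu> \<Longrightarrow> \<rho> (2 * k - 1) * \<rho> (2 * k) = \<rho>' (2 * k - 1) * \<rho>' (2 * k)"
    and j: "j \<in> {1..\<nu>}"
  shows "\<rho> j = \<rho>' j"
  using j
proof (induction j rule: less_induct)
  case (less j)
  have \<nu>: "1 \<le> \<nu>" using less.prems by simp
  have sg: "\<rho> l \<in> {1, -1}" "\<rho>' l \<in> {1, -1}" if "1 \<le> l" "l \<le> \<nu>" for l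
    using \<rho> that by (auto simp del: insert_iff)
  have "1 \<le> j" using less.prems by simp
  then show ?case
  proof (cases j rule: nat_pair_cases)
    case 1
    then show ?thesis using sign_class_eqD(1)[OF cl \<nu>] by simp
  next
    case (2 k)
    have "\<rho> (2 * k - 1) = \<rho>' (2 * k - 1)" using 2 less.prems by (intro less.IH) auto
    moreover have "\<rho> (2 * k - 1) = \<rho>' (2 * k - 1) \<longleftrightarrow> \<rho> (2 * k) = \<rho>' (2 * k)"
      using 2 less.prems by (intro sign_mult_cancel sg pairs) auto
    ultimately show ?thesis using 2 by simp
  next
    case (3 k)
    have "\<rho> (2 * k) = \<rho>' (2 * k)" using 3 less.prems by (intro less.IH) auto
    moreover have "\<rho> (2 * k) * \<rho> (2 * k + 1) = \<rho>' (2 * k) * \<rho>' (2 * k + 1)"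
      using sign_class_eqD(2)[OF cl \<nu>, of k] 3 less.prems by auto
    then have "\<rho> (2 * k) = \<rho>' (2 * k) \<longleftrightarrow> \<rho> (2 * k + 1) = \<rho>' (2 * k + 1)"
      using 3 less.prems by (intro sign_mult_cancel sg) auto
    ultimately show ?thesis using 3 by simp
  qed
qed

text \<open>
  The class records the entry at 1 and, for even \<open>\<nu>\<close>, the entry at \<open>\<nu>\<close>; for the other entries
  it records the product of a pair, so a change of one entry forces a change of the other.
\<close>

lemma sign_pair_differs:
  assumes \<rho>: "\<rho> \<in> {1..\<nu>} \<rightarrow> {1, -1}" "\<rho>' \<in> {1..\<nu>} \<rightarrow> {1, -1}"
    and cl: "sign_class \<nu> \<rho> = sign_class \<nu> \<rho>'"
    and j: "j \<in> {1..\<nu>}" "\<rho> j \<noteq> \<rho>' j"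
  shows "\<exists>k. 1 \<le> k \<and> 2 * k + 1 \<le> \<nu> \<and> \<rho> (2 * k) \<noteq> \<rho>' (2 * k) \<and> \<rho> (2 * k + 1) \<noteq> \<rho>' (2 * k + 1)"
proof -
  have \<nu>: "1 \<le> \<nu>" using j by simp
  have sg: "\<rho> l \<in> {1, -1}" "\<rho>' l \<in> {1, -1}" if "1 \<le> l" "l \<le> \<nu>" for l
    using \<rho> that by (auto simp del: insert_iff)
  have pair: "\<rho> (2 * k) = \<rho>' (2 * k) \<longleftrightarrow> \<rho> (2 * k + 1) = \<rho>' (2 * k + 1)" if "1 \<le> k" "2 * k + 1 \<le> \<nu>" for k
    using sign_class_eqD(2)[OF cl \<nu>, of k] that by (intro sign_mult_cancel sg) auto
  have "1 \<le> j" using j by simp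
  then show ?thesis
  proof (cases j rule: nat_pair_cases)
    case 1
    then show ?thesis using sign_class_eqD(1)[OF cl \<nu>] j by simp
  next
    case (2 k)
    then have "2 * k + 1 \<le> \<nu>" using sign_class_eqD(2)[OF cl \<nu>, of k] j by (cases "2 * k + 1 \<le> \<nu>") auto
    then show ?thesis using 2 pair[of k] j by blast
  next
    case (3 k)
    then show ?thesis using pair[of k] j by auto
  qed
qed

lemma diagonal_pair:
  assumes "1 \<le> k" "2 * k \<le> \<nu>" "\<rho> \<in> {1..\<nu>} \<rightarrow> {1, -1}"
  shows "grp_op (cls (eps (2 * k - 1))) (grp_op (cls (eps (2 * k))) (w_vec \<nu> \<rho> m))
    = pm_scale (- \<i> * of_int (\<rho> (2 * k - 1) * \<rho> (2 * k))) (w_vec \<nu> \<rho> m)"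
proof -
  have "2 * k - 1 \<in> {1..\<nu>}" "2 * k \<in> {1..\<nu>}" "odd (2 * k - 1)" using assms(1,2) by auto
  moreover have "flip_signs (2 * k - 1) (flip_signs (2 * k) \<rho>) = \<rho>"
    using assms(1) by (intro ext) (auto simp: flip_signs_def)
  moreover have "flip_signs (2 * k) \<rho> (2 * k - 1) = - \<rho> (2 * k - 1)"
    using assms(1) by (simp add: flip_signs_def)
  ultimately show ?thesis
    using assms grp_op_pair_w_vec[of "2 * k - 1" \<nu> "2 * k" \<rho> m] by (simp add: w_const_def mult_ac)
qed

text \<open>
  Separation of simultaneous eigenvectors: if two coefficients are nonzero, some \<open>e_(2k-1) e_(2k)\<close>
  has different eigenvalues there, and subtracting one of these eigenvalues kills one
  term but not the other.
\<close>

lemma isolate_w_vec: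
  fixes a :: "(nat \<Rightarrow> int) \<Rightarrow> complex"
  defines "R \<equiv> \<lambda>\<nu> \<gamma>. {\<rho> \<in> sign_vectors \<nu>. sign_class \<nu> \<rho> = \<gamma>}"
  assumes sub: "module.subspace pm_scale N"
    and cliff: "\<And>i j v. i \<in> {1..\<nu>} \<Longrightarrow> j \<in> {1..\<nu>} \<Longrightarrow> i \<noteq> j \<Longrightarrow> v \<in> N \<Longrightarrow> v \<in> group_part \<Longrightarrow>
      grp_op (cls (eps i)) (grp_op (cls (eps j)) v) \<in> N"
    and "(\<Sum>\<rho>\<in>R \<nu> \<gamma>. pm_scale (a \<rho>) (w_vec \<nu> \<rho> 0)) \<in> N" "\<exists>\<rho>\<in>R \<nu> \<gamma>. a \<rho> \<noteq> 0"
  shows "\<exists>\<rho>\<in>R \<nu> \<gamma>. w_vec \<nu> \<rho> 0 \<in> N"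
  using assms(4,5)
proof (induction "card {\<rho> \<in> R \<nu> \<gamma>. a \<rho> \<noteq> 0}" arbitrary: a rule: less_induct)
  case less
  let ?v = "\<lambda>a. \<Sum>\<rho>\<in>R \<nu> \<gamma>. pm_scale (a \<rho>) (w_vec \<nu> \<rho> 0)"
  have fin: "finite (R \<nu> \<gamma>)" by (simp add: R_def finite_sign_vectors)
  have at: "?v a \<in> group_part" for a
    by (auto simp: group_part_def in_keys_iff lookup_sum lookup_w_vec elim!: sum.not_neutral_contains_not_neutral split: if_splits)
  obtain \<rho> where \<rho>: "\<rho> \<in> R \<nu> \<gamma>" "a \<rho> \<noteq> 0" using less.prems by blast
  show ?case
  proof (cases "\<exists>\<rho>'\<in>R \<nu> \<gamma>. \<rho>' \<noteq> \<rho> \<and> a \<rho>' \<noteq> 0")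
    case False
    then have "?v a = (\<Sum>\<rho>'\<in>R \<nu> \<gamma>. if \<rho>' = \<rho> then pm_scale (a \<rho>) (w_vec \<nu> \<rho> 0) else 0)"
      by (intro sum.cong refl) auto
    also have "\<dots> = pm_scale (a \<rho>) (w_vec \<nu> \<rho> 0)" using fin \<rho> by simp
    finally have "pm_scale (a \<rho>) (w_vec \<nu> \<rho> 0) \<in> N" using less.prems(1) by simp
    then have "pm_scale (inverse (a \<rho>)) (pm_scale (a \<rho>) (w_vec \<nu> \<rho> 0)) \<in> N"
      by (rule pm.subspace_scale[OF sub])
    then show ?thesis using \<rho> by (intro bexI[of _ \<rho>]) simp_all
  next
    case True
    then obtain \<rho>' where \<rho>': "\<rho>' \<in> R \<nu> \<gamma>" "\<rho>' \<noteq> \<rho>" "a \<rho>' \<noteq> 0" by blast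
    have R: "\<rho> \<in> {1..\<nu>} \<rightarrow>\<^sub>E {1, -1}" "sign_class \<nu> \<rho> = \<gamma>" if "\<rho> \<in> R \<nu> \<gamma>" for \<rho>
      using that by (simp_all add: R_def sign_vectors_def)
    have "\<exists>k. 1 \<le> k \<and> 2 * k \<le> \<nu> \<and> \<rho> (2 * k - 1) * \<rho> (2 * k) \<noteq> \<rho>' (2 * k - 1) * \<rho>' (2 * k)"
    proof (rule ccontr)
      assume "\<not> ?thesis"
      then have "\<rho> j = \<rho>' j" if "j \<in> {1..\<nu>}" for j
        using R[OF \<rho>(1)] R[OF \<rho>'(1)] that
        by (intro sign_vector_determined[of \<rho> \<nu> \<rho>' j]) (auto simp: PiE_def)
      then have "\<rho> = \<rho>'" using R[OF \<rho>(1)] R[OF \<rho>'(1)] by (intro PiE_ext) auto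
      then show False using \<rho>' by simp
    qed
    then obtain k where k: "1 \<le> k" "2 * k \<le> \<nu>"
      "\<rho> (2 * k - 1) * \<rho> (2 * k) \<noteq> \<rho>' (2 * k - 1) * \<rho>' (2 * k)" by blast
    define ev where "ev r = - \<i> * of_int (r (2 * k - 1) * r (2 * k))" for r :: "nat \<Rightarrow> int"
    \<comment> \<open>the coefficients after applying the operator minus its eigenvalue at
       \<open>\<rho>\<close>\<close>
    define b where "b r = (ev r - ev \<rho>) * a r" for r
    have "ev \<rho>' \<noteq> ev \<rho>" using k(3) by (simp add: ev_def del: of_int_mult)
    have "grp_op (cls (eps (2 * k - 1))) (grp_op (cls (eps (2 * k))) (?v a)) \<in> N"
      using k less.prems(1) at by (intro cliff) auto
    also have "grp_op (cls (eps (2 * k - 1))) (grp_op (cls (eps (2 * k))) (?v a))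
        = (\<Sum>r\<in>R \<nu> \<gamma>. pm_scale (a r) (grp_op (cls (eps (2 * k - 1))) (grp_op (cls (eps (2 * k))) (w_vec \<nu> r 0))))"
      by (simp only: grp_op_sum grp_op_scale)
    also have "\<dots> = (\<Sum>r\<in>R \<nu> \<gamma>. pm_scale (ev r * a r) (w_vec \<nu> r 0))"
    proof (intro sum.cong refl)
      fix r assume "r \<in> R \<nu> \<gamma>"
      then have "r \<in> {1..\<nu>} \<rightarrow> {1, -1}" using R(1) by (auto simp: PiE_def)
      from diagonal_pair[OF k(1,2) this, of 0]
      show "pm_scale (a r) (grp_op (cls (eps (2 * k - 1))) (grp_op (cls (eps (2 * k))) (w_vec \<nu> r 0)))
        = pm_scale (ev r * a r) (w_vec \<nu> r 0)"
        by (simp only: pm.scale_scale ev_def mult.commute)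
    qed
    finally have "(\<Sum>r\<in>R \<nu> \<gamma>. pm_scale (ev r * a r) (w_vec \<nu> r 0)) - pm_scale (ev \<rho>) (?v a) \<in> N"
      using less.prems(1) by (intro pm.subspace_diff[OF sub] pm.subspace_scale[OF sub])
    also have "(\<Sum>r\<in>R \<nu> \<gamma>. pm_scale (ev r * a r) (w_vec \<nu> r 0)) - pm_scale (ev \<rho>) (?v a) = ?v b"
      by (simp add: b_def pm.scale_sum_right sum_subtractf[symmetric] pm.scale_left_diff_distrib left_diff_distrib)
    finally have "?v b \<in> N" .
    moreover have "b \<rho>' \<noteq> 0" using \<open>ev \<rho>' \<noteq> ev \<rho>\<close> \<rho>' by (simp add: b_def)
    moreover have "card {r \<in> R \<nu> \<gamma>. b r \<noteq> 0} < card {r \<in> R \<nu> \<gamma>. a r \<noteq> 0}"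
    proof (rule psubset_card_mono)
      show "{r \<in> R \<nu> \<gamma>. b r \<noteq> 0} \<subset> {r \<in> R \<nu> \<gamma>. a r \<noteq> 0}" using \<rho> by (auto simp: b_def)
    qed (use fin in simp)
    ultimately show ?thesis using less.hyps[of b] \<rho>'(1) by blast
  qed
qed

lemma w_const_nonzero: "w_const j \<noteq> 0"
  by (simp add: w_const_def)

lemma sign_nonzero:
  assumes "\<rho> \<in> {1..\<nu>} \<rightarrow> {1, -1 :: int}" "j \<in> {1..\<nu>}"
  shows "\<rho> j \<noteq> 0"
  using Pi_mem[OF assms] by auto

text \<open>
  The product \<open>e_(2k) e_(2k+1)\<close> negates exactly the entries \<open>2k\<close> and \<open>2k + 1\<close>. Two sign vectors of the
  same class differ in a union of such pairs, so they are joined by these moves.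
\<close>

lemma w_vec_transitive:
  assumes sub: "module.subspace pm_scale N"
    and cliff: "\<And>i j v. i \<in> {1..\<nu>} \<Longrightarrow> j \<in> {1..\<nu>} \<Longrightarrow> i \<noteq> j \<Longrightarrow> v \<in> N \<Longrightarrow> v \<in> group_part \<Longrightarrow>
      grp_op (cls (eps i)) (grp_op (cls (eps j)) v) \<in> N"
    and "w_vec \<nu> \<rho> 0 \<in> N" "\<rho> \<in> {1..\<nu>} \<rightarrow> {1, -1}" "sign_class \<nu> \<rho> = sign_class \<nu> \<rho>'"
    and \<rho>': "\<rho>' \<in> {1..\<nu>} \<rightarrow> {1, -1}"
  shows "w_vec \<nu> \<rho>' 0 \<in> N"
  using assms(3-5)
proof (induction "card {j \<in> {1..\<nu>}. \<rho> j \<noteq> \<rho>' j}" arbitrary: \<rho> rule: less_induct)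
  case less
  show ?case
  proof (cases "\<exists>j\<in>{1..\<nu>}. \<rho> j \<noteq> \<rho>' j")
    case False
    then show ?thesis using less.prems(1) w_vec_cong[of \<nu> \<rho> \<rho>' 0] by auto
  next
    case True
    then obtain k where k: "1 \<le> k" "2 * k + 1 \<le> \<nu>" "\<rho> (2 * k) \<noteq> \<rho>' (2 * k)" "\<rho> (2 * k + 1) \<noteq> \<rho>' (2 * k + 1)"
      using sign_pair_differs[OF less.prems(2) \<rho>' less.prems(3)] by blast
    let ?f = "flip_signs (2 * k) (flip_signs (2 * k + 1) \<rho>)"
    have ij: "2 * k \<in> {1..\<nu>}" "2 * k + 1 \<in> {1..\<nu>}" using k by auto
    have f: "?f = (\<lambda>l. if l = 2 * k \<or> l = 2 * k + 1 then - \<rho> l else \<rho> l)"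
      using k by (intro ext) (auto simp: flip_signs_def)
    have sg: "\<rho> l \<in> {1, -1}" "\<rho>' l \<in> {1, -1}" if "l \<in> {1..\<nu>}" for l
      using less.prems(2) \<rho>' that by (auto simp del: insert_iff)
    define c where "c = w_const (2 * k + 1) * of_int (\<rho> (2 * k + 1))
        * (w_const (2 * k) * of_int (flip_signs (2 * k + 1) \<rho> (2 * k)))"
    have "c \<noteq> 0"
      unfolding c_def mult_eq_0_iff de_Morgan_disj of_int_eq_0_iff
      by (intro conjI w_const_nonzero sign_nonzero[OF less.prems(2) ij(2)]
          sign_nonzero[OF flip_signs_signs[OF less.prems(2)] ij(1)])
    have "w_vec \<nu> \<rho> 0 \<in> group_part"
      by (auto simp: group_part_def in_keys_iff lookup_w_vec split: if_splits)
    then have "pm_scale c (w_vec \<nu> ?f 0) \<in> N"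
      using cliff[OF ij _ less.prems(1)] grp_op_pair_w_vec[OF ij less.prems(2)] by (simp add: c_def)
    then have "pm_scale (inverse c) (pm_scale c (w_vec \<nu> ?f 0)) \<in> N" by (rule pm.subspace_scale[OF sub])
    then have "w_vec \<nu> ?f 0 \<in> N" using \<open>c \<noteq> 0\<close> by simp
    moreover have "card {j \<in> {1..\<nu>}. ?f j \<noteq> \<rho>' j} < card {j \<in> {1..\<nu>}. \<rho> j \<noteq> \<rho>' j}"
    proof (rule psubset_card_mono)
      have "- \<rho> (2 * k) = \<rho>' (2 * k)" "- \<rho> (2 * k + 1) = \<rho>' (2 * k + 1)"
        using sg[OF ij(1)] sg[OF ij(2)] k by auto
      then show "{j \<in> {1..\<nu>}. ?f j \<noteq> \<rho>' j} \<subset> {j \<in> {1..\<nu>}. \<rho> j \<noteq> \<rho>' j}"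
        unfolding f using k ij by (intro psubsetI) (auto split: if_splits)
    qed simp
    moreover have "?f \<in> {1..\<nu>} \<rightarrow> {1, -1}" by (intro flip_signs_signs less.prems(2))
    moreover have "sign_class \<nu> ?f = sign_class \<nu> \<rho>'"
      using less.prems(3) by (simp only: sign_class_flip_flip[OF ij])
    ultimately show ?thesis by (intro less.hyps)
  qed
qed

lemma w_vec_create:
  assumes N: "heis_stable \<nu> N" and \<rho>: "w_vec \<nu> \<rho> 0 \<in> N" and m: "m \<in> neg_odd_monos \<nu>"
  shows "w_vec \<nu> \<rho> m \<in> N"
  using m
proof (induction "mono_degree m" arbitrary: m)
  case 0
  then have "m = 0" by (simp add: mono_degree_eq_0_iff)
  then show ?case using \<rho> by simp
next
  case (Suc d)
  then have "mono_degree m \<noteq> 0" by simp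
  then have "m \<noteq> 0" by (simp only: mono_degree_eq_0_iff not_False_eq_True)
  then obtain i n where k: "(i, n) \<in> keys m" by (rule mono_nonzero_key)
  then have i: "i \<in> {1..\<nu>}" "n < 0" "odd n" using Suc.prems by (auto simp: neg_odd_monos_def)
  let ?m = "m - Poly_Mapping.single (i, n) 1"
  have "mono_degree m = Suc (mono_degree ?m)"
    using mono_degree_add_single[of ?m "(i, n)"] mono_diff_add_single[OF k] by simp
  then have "w_vec \<nu> \<rho> ?m \<in> N"
    using Suc neg_odd_monos_diff by simp
  then have "heis1 i n (w_vec \<nu> \<rho> ?m) \<in> N" using N i by (simp add: heis_stable_def)
  then show ?case using i(2) mono_diff_add_single[OF k] by (simp add: heis1_w_vec)
qed

text \<open>
  Annihilation leads from any nonzero vector into the group algebra, the diagonal Clifford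
  products isolate a single \<open>w(\<rho>) \<otimes> 1\<close> there, and the other Clifford products together with the
  creation operators recover the rest of the block from it.
\<close>

lemma fock_block_minimal:
  assumes "1 \<le> \<nu>" and N: "heis_stable \<nu> N" "N \<subseteq> fock_block \<nu> \<gamma>" "N \<noteq> {0}"
    and cliff: "\<And>i j v. i \<in> {1..\<nu>} \<Longrightarrow> j \<in> {1..\<nu>} \<Longrightarrow> i \<noteq> j \<Longrightarrow> v \<in> N \<Longrightarrow> v \<in> group_part \<Longrightarrow>
      grp_op (cls (eps i)) (grp_op (cls (eps j)) v) \<in> N"
  shows "N = fock_block \<nu> \<gamma>"
proof
  let ?R = "{\<rho> \<in> sign_vectors \<nu>. sign_class \<nu> \<rho> = \<gamma>}"
  have sub: "module.subspace pm_scale N" using N(1) by (simp add: heis_stable_def)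
  then obtain v where "v \<in> N" "v \<noteq> 0" using N(3) pm.subspace_0 by blast
  moreover have "N \<subseteq> Fock \<nu>" using N(2) fock_block_Fock by blast
  ultimately obtain w where w: "w \<in> N" "w \<noteq> 0" "w \<in> group_part"
    using exists_vacuum_vector[OF N(1)] by blast
  then obtain a where a: "w = (\<Sum>\<rho>\<in>?R. pm_scale (a \<rho>) (w_vec \<nu> \<rho> 0))"
    using group_part_expansion[OF assms(1), of w \<gamma>] N(2) by blast
  have "\<exists>\<rho>\<in>?R. a \<rho> \<noteq> 0"
  proof (rule ccontr)
    assume "\<not> ?thesis"
    then have "w = 0" unfolding a by (intro sum.neutral) auto
    with w show False by simp
  qed
  then obtain \<rho> where \<rho>: "\<rho> \<in> ?R" "w_vec \<nu> \<rho> 0 \<in> N"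
    using isolate_w_vec[OF sub cliff, of \<nu> a \<gamma>] w(1) unfolding a by blast
  have "w_vec \<nu> \<rho>' m \<in> N"
    if "\<rho>' \<in> {1..\<nu>} \<rightarrow> {1, -1}" "sign_class \<nu> \<rho>' = \<gamma>" "m \<in> neg_odd_monos \<nu>" for \<rho>' m
  proof (rule w_vec_create[OF N(1) _ that(3)])
    show "w_vec \<nu> \<rho>' 0 \<in> N"
      by (rule w_vec_transitive[OF sub cliff \<rho>(2)]) (use \<rho>(1) that in \<open>auto simp: sign_vectors_def PiE_def\<close>)
  qed
  then show "fock_block \<nu> \<gamma> \<subseteq> N" using fock_block_induct[OF _ sub] by blast
qed (rule N(2))

section \<open>The Fock space as a module\<close>

lemma direct_sum_cong:
  assumes "\<And>i. i \<in> I \<Longrightarrow> W i = W' i"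
  shows "direct_sum I W V \<longleftrightarrow> direct_sum I W' V"
  using assms by (simp add: direct_sum_def cong: ball_cong)

lemma x_op_diagonal: "odd n \<Longrightarrow> x_op i i 1 n v = pm_scale 4 (heis1 i n v)"
  by (simp add: x_op_def heis_eps)

lemma x_op_vacuum:
  assumes "i \<in> {1..\<nu>}" "j \<in> {1..\<nu>}" "i \<noteq> j" "vacuum \<nu> v"
  shows "x_op i j a 0 v = grp_op (cls (eps i)) (grp_op (cls (eps j)) v)"
  using assms by (simp add: x_op_def grp_op_eps_diff EE_coeff_vacuum)

theorem theorem3p5:
  fixes \<nu> :: nat
    and \<sigma> :: "'g::ab_group_add \<Rightarrow> complex"
    and act :: "'g rmat \<times> complex \<Rightarrow> fock \<Rightarrow> fock"
  assumes "2 \<le> \<nu>"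
    and "character \<sigma>"
    and "lie_module (uhat \<nu> \<sigma>) ghat_scale (ghat_bracket \<nu> \<sigma>) (Fock \<nu>) pm_scale act"
    and "\<And>i j m \<alpha> v. i \<in> {1..\<nu>} \<Longrightarrow> j \<in> {1..\<nu>} \<Longrightarrow> v \<in> Fock \<nu> \<Longrightarrow>
           act (ghat_scale 2 (e_gen \<sigma> i j m \<alpha>, 0)) v =
             x_op i j (\<sigma> \<alpha>) m v +
             (if m = 0 \<and> i = j \<and> \<sigma> \<alpha> \<noteq> 1
              then pm_scale ((1 + \<sigma> \<alpha>) / (1 - \<sigma> \<alpha>)) v else 0)"
    and "\<And>v. v \<in> Fock \<nu> \<Longrightarrow> act (0, 1) v = pm_scale (1/2) v"
  shows "completely_reducible (uhat \<nu> \<sigma>) (Fock \<nu>) pm_scale act \<and>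
    direct_sum ({1..\<nu> div 2 + 1} \<rightarrow>\<^sub>E {1, -1})
      (\<lambda>\<gamma>. tensor_space (V_space \<nu> \<gamma>) (Sym \<nu>)) (Fock \<nu>) \<and>
    (\<forall>\<gamma> \<in> {1..\<nu> div 2 + 1} \<rightarrow>\<^sub>E {1, -1}.
      irreducible_submodule (uhat \<nu> \<sigma>) (Fock \<nu>) pm_scale act
        (tensor_space (V_space \<nu> \<gamma>) (Sym \<nu>)))"
proof -
  let ?I = "{1..\<nu> div 2 + 1} \<rightarrow>\<^sub>E {1, -1 :: int}"
  have \<nu>: "1 \<le> \<nu>" using assms(1) by simp
  note gen_act = assms(4)
  have block_submodule: "submodule (uhat \<nu> \<sigma>) (Fock \<nu>) pm_scale act (fock_block \<nu> \<gamma>)" for \<gamma>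
  proof (rule lie_module_stable[OF assms(2,3) subspace_fock_block fock_block_Fock])
    fix v assume v: "v \<in> fock_block \<nu> \<gamma>"
    then have "v \<in> Fock \<nu>" using fock_block_Fock by blast
    then show "act (0, 1) v \<in> fock_block \<nu> \<gamma>"
      using v by (simp add: assms(5) pm.subspace_scale[OF subspace_fock_block])
    fix i j m \<alpha> assume "i \<in> {1..\<nu>}" "j \<in> {1..\<nu>}"
    with v \<open>v \<in> Fock \<nu>\<close> show "act (ghat_scale 2 (e_gen \<sigma> i j m \<alpha>, 0)) v \<in> fock_block \<nu> \<gamma>"
      by (simp only: gen_act)
         (intro pm.subspace_add[OF subspace_fock_block] x_op_stable,
          auto intro: pm.subspace_scale[OF subspace_fock_block] pm.subspace_0[OF subspace_fock_block])
  qed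
  have gen_closed: "x_op i j 1 m v \<in> N"
    if N: "submodule (uhat \<nu> \<sigma>) (Fock \<nu>) pm_scale act N"
      and ij: "i \<in> {1..\<nu>}" "j \<in> {1..\<nu>}" and v: "v \<in> N" for N i j m v
  proof -
    have "act (ghat_scale 2 (e_gen \<sigma> i j m 0, 0)) v \<in> N"
      using N v uhat_scale[OF e_gen_uhat[OF assms(2) ij]] by (simp add: submodule_def)
    moreover have "v \<in> Fock \<nu>" using N v by (auto simp: submodule_def)
    ultimately show ?thesis using gen_act[OF ij, of v m 0] character_zero[OF assms(2)] by simp
  qed
  have block_irreducible: "irreducible_submodule (uhat \<nu> \<sigma>) (Fock \<nu>) pm_scale act (fock_block \<nu> \<gamma>)"
    if \<gamma>: "\<gamma> \<in> ?I" for \<gamma>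
    unfolding irreducible_submodule_def
  proof (intro conjI allI impI)
    show "submodule (uhat \<nu> \<sigma>) (Fock \<nu>) pm_scale act (fock_block \<nu> \<gamma>)" by (rule block_submodule)
    show "fock_block \<nu> \<gamma> \<noteq> {0}" using block_nonzero[OF \<gamma>] by blast
    fix N assume "submodule (uhat \<nu> \<sigma>) (Fock \<nu>) pm_scale act N \<and> N \<subseteq> fock_block \<nu> \<gamma>"
    then have N: "submodule (uhat \<nu> \<sigma>) (Fock \<nu>) pm_scale act N" "N \<subseteq> fock_block \<nu> \<gamma>" by auto
    have sub: "module.subspace pm_scale N" using N(1) by (simp add: submodule_def)
    have "heis_stable \<nu> N"
      unfolding heis_stable_def
    proof (intro conjI sub ballI allI impI)
      fix i n v assume i: "i \<in> {1..\<nu>}" "odd (n::int)" "v \<in> N"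
      \<comment> \<open>the action of \<open>e_ii(n, 0)\<close> recovers \<open>\<epsilon>\<^sub>i(n)\<close>,
         as \<open>X_ii(1, z) = 4 \<epsilon>\<^sub>i(z)\<close>\<close>
      have "pm_scale (1/4) (x_op i i 1 n v) \<in> N"
        by (rule pm.subspace_scale[OF sub gen_closed[OF N(1) i(1) i(1) i(3)]])
      then show "heis1 i n v \<in> N" using i(2) by (simp add: x_op_diagonal)
    qed
    moreover have "grp_op (cls (eps i)) (grp_op (cls (eps j)) v) \<in> N"
      if "i \<in> {1..\<nu>}" "j \<in> {1..\<nu>}" "i \<noteq> j" "v \<in> N" "v \<in> group_part" for i j v
      using gen_closed[OF N(1) that(1,2,4), of 0] x_op_vacuum[OF that(1-3) vacuum_if_group_part[OF that(5)]]
      by simp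
    ultimately show "N = {0} \<or> N = fock_block \<nu> \<gamma>"
      using fock_block_minimal[OF \<nu> _ N(2)] by blast
  qed
  have "completely_reducible (uhat \<nu> \<sigma>) (Fock \<nu>) pm_scale act"
    unfolding completely_reducible_def using block_irreducible direct_sum_block_set[OF \<nu>] by blast
  moreover have "direct_sum ?I (\<lambda>\<gamma>. tensor_space (V_space \<nu> \<gamma>) (Sym \<nu>)) (Fock \<nu>)"
  proof (subst direct_sum_cong)
    show "tensor_space (V_space \<nu> \<gamma>) (Sym \<nu>) = fock_block \<nu> \<gamma>" if "\<gamma> \<in> ?I" for \<gamma>
      using that by (rule tensor_space_eq_block[OF assms(1)])
    show "direct_sum ?I (fock_block \<nu>) (Fock \<nu>)" by (rule direct_sum_blocks[OF \<nu>])
  qed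
  moreover have "\<forall>\<gamma>\<in>?I. irreducible_submodule (uhat \<nu> \<sigma>) (Fock \<nu>) pm_scale act
      (tensor_space (V_space \<nu> \<gamma>) (Sym \<nu>))"
    using block_irreducible tensor_space_eq_block[OF assms(1)] by simp
  ultimately show ?thesis by blast
qed

end
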